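(* Let $(X,\tau)$ be a zero-dimensional Hausdorff space. Then: (a) Let $(A,I)\in\mathcal{ZA}(X,\tau)$. Put $\mathcal{B}=\{M\subseteq X : \exists B\in I \text{ such that } M\subseteq B\}$; for $M,N\in\mathcal{B}$ let $M\,\delta\,N$ iff for every $F\in I$ with $M\subseteq F$ one has $F\cap N\neq\emptyset$; further, for arbitrary $K,L\subseteq X$ let $K\,\delta\,L$ iff there exist $M,N\in\mathcal{B}$ with $M\subseteq K$, $N\subseteq L$ and $M\,\delta\,N$. Then $(X,\delta,\mathcal{B})\in\mathcal{LP}_0(X,\tau)$. Set $L_X(A,I)=(X,\delta,\mathcal{B})$. (b) Let $(X,\delta,\mathcal{B})\in\mathcal{LP}_0(X,\tau)$. Put $A=\{F\subseteq X : F\ll F\}$ and $I=A\cap\mathcal{B}$. Then $(A,I)\in\mathcal{ZA}(X,\tau)$. Set $l_X(X,\delta,\mathcal{B})=(A,I)$. (c) $\beta_X^0=(\Lambda_X)^{-1}\circ L_X$, and for every $(X,\delta,\mathcal{B})\in\mathcal{LP}_0(X,\tau)$, $(\beta_X^0\circ l_X)(X,\delta,\mathcal{B})=(\Lambda_X)^{-1}(X,\delta,\mathcal{B})$. (d) The correspondence $L_X:(\mathcal{ZA}(X,\tau),\preceq_0)\to(\mathcal{LP}_0(X,\tau),\preceq)$ is an isomorphism of posets and $L_X^{-1}=l_X$.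
   Context: A space is zero-dimensional if it has a base of clopen sets. $CO(X)$ is the Boolean algebra of all clopen subsets of $X$. Extensions. An extension of $X$ is a pair $(Y,f)$ where $f:X\to Y$ is a homeomorphic embedding with dense image. Two extensions $(Y_1,f_1),(Y_2,f_2)$ are equivalent if there is a homeomorphism $h:Y_1\to Y_2$ with $h\circ f_1=f_2$; $[(Y,f)]$ denotes the equivalence class. $\mathcal{L}(X)$ (resp. $\mathcal{L}_0(X)$) is the set of equivalence classes of locally compact Hausdorff (resp. zero-dimensional locally compact Hausdorff) extensions of $X$. ZLB-algebras. A local Boolean algebra (LBA) is a pair $(A,I)$ where $A$ is a Boolean algebra and $I$ is an ideal of $A$ (possibly $I=A$) that is dense in $A$: for every $a\in A\setminus\{0\}$ there is $b\in I\setminus\{0\}$ with $b\le a$. Let $Idl(I)$ be the frame of all ideals of $I$ ($I$ regarded as a distributive lattice with $0$, possibly without top); for $J\in Idl(I)$ let $\neg J=\bigvee\{K\in Idl(I) : K\wedge J=\{0\}\}$; $J$ is simple if $J\vee\neg J=I$ in $Idl(I)$. An LBA $(A,I)$ is a ZLB-algebra (ZLBA) if for every simple ideal $J$ of $I$ the join $\bigvee_A J$ exists in $A$. A ZLBA $(A,I)$ is admissible for $X$ if $A$ is a Boolean subalgebra of $CO(X)$ and $I$ is an open base of $X$. $\mathcal{ZA}(X)=\mathcal{ZA}(X,\tau)$ is the set of all ZLBAs admissible for $X$; $(A_1,I_1)\preceq_0(A_2,I_2)$ means that $A_1$ is a Boolean subalgebra of $A_2$ and for every $V\in I_2$ there is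 $U\in I_1$ with $V\subseteq U$. The map $\beta_X^0:\mathcal{ZA}(X)\to\mathcal{L}_0(X)$. For $(A,I)\in\mathcal{ZA}(X)$ let $\Theta^a(A,I)$ be the set $\{u : u \text{ an ultrafilter in } A,\ u\cap I\neq\emptyset\}$ with the topology having the sets $\{u : a\in u\}$, $a\in I$, as an open base; let $f_{(A,I)}:X\to\Theta^a(A,I)$, $x\mapsto\{F\in A : x\in F\}$. This is a zero-dimensional locally compact Hausdorff extension of $X$, and $\beta_X^0(A,I)=[(\Theta^a(A,I),f_{(A,I)})]$. Local proximities. A local proximity space is a triple $(X,\delta,\mathcal{B})$ where $X$ is a set, $\mathcal{B}$ is an ideal (possibly non-proper) of the power set $P(X)$, and $\delta$ is a symmetric binary relation on $P(X)$ such that (writing $D\ll E$ iff not $D\,\delta\,(X\setminus E)$): (P1) not $\emptyset\,\delta\,A$ for every $A\subseteq X$; (P2) $A\,\delta\,A$ for every $A\ne\emptyset$; (P3) $A\,\delta\,(B\cup C)$ iff $A\,\delta\,B$ or $A\,\delta\,C$; (BC1) if $A\in\mathcal{B}$, $C\subseteq X$ and $A\ll C$, then there is $B\in\mathcal{B}$ with $A\ll B\ll C$; (BC2) if $A\,\delta\,C$, then there is $B\in\mathcal{B}$ with $B\subseteq C$ and $A\,\delta\,B$. It is separated if $\{x\}\,\delta\,\{y\}$ iff $x=y$. A separated local proximity space induces a Tychonoff topology on $X$ by $\mathrm{cl}(M)=\{x\in X : \{x\}\,\delta\,M\}$; it is a local proximity space on $(X,\tau)$ if this topology is $\tau$. $\mathcal{LP}(X,\tau)$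 is the set of separated local proximity spaces on $(X,\tau)$, ordered by $(X,\beta_1,\mathcal{B}_1)\preceq(X,\beta_2,\mathcal{B}_2)$ iff $\beta_2\subseteq\beta_1$ and $\mathcal{B}_2\subseteq\mathcal{B}_1$. $(X,\delta,\mathcal{B})$ is zero-dimensional if for all $A,B\in\mathcal{B}$ with $A\ll B$ there is $C\subseteq X$ with $A\subseteq C\subseteq B$ and $C\ll C$. $\mathcal{LP}_0(X,\tau)\subseteq\mathcal{LP}(X,\tau)$ is the subset of zero-dimensional ones, with the restricted order. The map $\Lambda_X$. By a theorem of Leader, for a Tychonoff space $(X,\tau)$ there is an order isomorphism $\Lambda_X:\mathcal{L}(X)\to\mathcal{LP}(X,\tau)$ (where $[(Y_1,f_1)]\le[(Y_2,f_2)]$ iff there is a continuous $h:Y_2\to Y_1$ with $f_1=h\circ f_2$), given by $\Lambda_X([(Y,f)])=(X,\rho,\mathcal{B})$, where $M\,\rho\,N$ iff $\mathrm{cl}_Y(f(M))\cap\mathrm{cl}_Y(f(N))\ne\emptyset$, and $M\in\mathcal{B}$ iff $\mathrm{cl}_Y(f(M))$ is compact. *)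

theory Defs
  imports "HOL-Analysis.Analysis"
begin

definition clopens :: "'a topology \<Rightarrow> 'a set set" where
  "clopens X = {U. openin X U \<and> closedin X U}"

definition open_base :: "'a topology \<Rightarrow> 'a set set \<Rightarrow> bool" where
  "open_base X \<B> \<longleftrightarrow> openin X = arbitrary union_of (\<lambda>U. U \<in> \<B>)"

definition zero_dimensional_space :: "'a topology \<Rightarrow> bool" where
  "zero_dimensional_space X \<longleftrightarrow> (\<exists>\<B>. \<B> \<subseteq> clopens X \<and> open_base X \<B>)"

text \<open>
  A map \<open>f :: 'a \<Rightarrow> 'b\<close> is only relevant on \<open>topspace X\<close>; pairs differing only outside of it
  are equivalent.
\<close>

definition extensions :: "'a topology \<Rightarrow> ('b topology \<times> ('a \<Rightarrow> 'b)) set" where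
  "extensions X =
     {(Y, f). embedding_map X Y f \<and> Y closure_of (f ` topspace X) = topspace Y}"

definition ext_equiv ::
  "'a topology \<Rightarrow> (('b topology \<times> ('a \<Rightarrow> 'b)) \<times> ('b topology \<times> ('a \<Rightarrow> 'b))) set" where
  "ext_equiv X =
     {((Y1, f1), (Y2, f2)).
        (Y1, f1) \<in> extensions X \<and> (Y2, f2) \<in> extensions X \<and>
        (\<exists>h. homeomorphic_map Y1 Y2 h \<and> (\<forall>x \<in> topspace X. h (f1 x) = f2 x))}"

text \<open>
  In a Hausdorff extension \<open>(Y, f)\<close> of \<open>X\<close> a point \<open>y\<close> is determined by its trace
  \<open>{topspace X \<inter> f -` U | U open in Y, y \<in> U}\<close>, so every such extension is equivalent to one whose
  points have type \<open>'a set set\<close>. Hence fixing this type of points loses no equivalence class.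
\<close>

type_synonym 'a ext = "'a set set topology \<times> ('a \<Rightarrow> 'a set set)"

definition lc_hausdorff_ext_classes :: "'a topology \<Rightarrow> 'a ext set set" where
  "lc_hausdorff_ext_classes X =
     {(Y, f) \<in> extensions X. locally_compact_space Y \<and> Hausdorff_space Y} // ext_equiv X"

text \<open>
  Boolean algebras occur here only as subalgebras of \<open>clopens X\<close>. They are therefore taken to be
  fields of sets (locale \<open>algebra\<close>): the order is \<open>\<subseteq>\<close> and the top is \<open>\<Omega>\<close>.
  \<open>Idl D\<close> is the set of ideals of a lattice of sets \<open>D\<close> with least element \<open>{}\<close>.
\<close>

definition Idl :: "'a set set \<Rightarrow> 'a set set set" where
  "Idl D = {J. J \<subseteq> D \<and> {} \<in> J \<and>
               (\<forall>a \<in> J. \<forall>b \<in> D. b \<subseteq> a \<longrightarrow> b \<in> J) \<and>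
               (\<forall>a \<in> J. \<forall>b \<in> J. a \<union> b \<in> J)}"

definition Idl_Join :: "'a set set \<Rightarrow> 'a set set set \<Rightarrow> 'a set set" where
  "Idl_Join D \<J> = \<Inter>{K \<in> Idl D. \<forall>J \<in> \<J>. J \<subseteq> K}"

definition Idl_neg :: "'a set set \<Rightarrow> 'a set set \<Rightarrow> 'a set set" where
  "Idl_neg D J = Idl_Join D {K \<in> Idl D. K \<inter> J = {{}}}"

definition simple_ideal :: "'a set set \<Rightarrow> 'a set set \<Rightarrow> bool" where
  "simple_ideal D J \<longleftrightarrow> J \<in> Idl D \<and> Idl_Join D {J, Idl_neg D J} = D"

definition LBA :: "'a set \<Rightarrow> 'a set set \<Rightarrow> 'a set set \<Rightarrow> bool" where
  "LBA \<Omega> A I \<longleftrightarrow> algebra \<Omega> A \<and> I \<in> Idl A \<and>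
     (\<forall>a \<in> A - {{}}. \<exists>b \<in> I - {{}}. b \<subseteq> a)"

text \<open>The join of \<open>J\<close> is taken in the poset \<open>A\<close>; it need not be the union of \<open>J\<close>.\<close>

definition has_join_in :: "'a set set \<Rightarrow> 'a set set \<Rightarrow> bool" where
  "has_join_in A J \<longleftrightarrow>
     (\<exists>s \<in> A. (\<forall>a \<in> J. a \<subseteq> s) \<and> (\<forall>t \<in> A. (\<forall>a \<in> J. a \<subseteq> t) \<longrightarrow> s \<subseteq> t))"

definition ZLBA :: "'a set \<Rightarrow> 'a set set \<Rightarrow> 'a set set \<Rightarrow> bool" where
  "ZLBA \<Omega> A I \<longleftrightarrow> LBA \<Omega> A I \<and> (\<forall>J. simple_ideal I J \<longrightarrow> has_join_in A J)"

definition ZA :: "'a topology \<Rightarrow> ('a set set \<times> 'a set set) set" where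
  "ZA X = {(A, I). ZLBA (topspace X) A I \<and> A \<subseteq> clopens X \<and> open_base X I}"

definition ZA_le :: "('a set set \<times> 'a set set) \<Rightarrow> ('a set set \<times> 'a set set) \<Rightarrow> bool" where
  "ZA_le = (\<lambda>(A1, I1) (A2, I2). A1 \<subseteq> A2 \<and> (\<forall>V \<in> I2. \<exists>U \<in> I1. V \<subseteq> U))"

definition proper_filter_in :: "'a set set \<Rightarrow> 'a set set \<Rightarrow> bool" where
  "proper_filter_in A u \<longleftrightarrow> u \<subseteq> A \<and> u \<noteq> {} \<and> {} \<notin> u \<and>
     (\<forall>a \<in> u. \<forall>b \<in> A. a \<subseteq> b \<longrightarrow> b \<in> u) \<and>
     (\<forall>a \<in> u. \<forall>b \<in> u. a \<inter> b \<in> u)"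

definition ultrafilter_in :: "'a set set \<Rightarrow> 'a set set \<Rightarrow> bool" where
  "ultrafilter_in A u \<longleftrightarrow> proper_filter_in A u \<and>
     (\<forall>v. proper_filter_in A v \<longrightarrow> u \<subseteq> v \<longrightarrow> v = u)"

definition bounded_ultrafilters :: "'a set set \<Rightarrow> 'a set set \<Rightarrow> 'a set set set" where
  "bounded_ultrafilters A I = {u. ultrafilter_in A u \<and> u \<inter> I \<noteq> {}}"

definition Theta :: "'a set set \<Rightarrow> 'a set set \<Rightarrow> 'a set set topology" where
  "Theta A I = topology (arbitrary union_of
     (\<lambda>U. \<exists>a \<in> I. U = {u \<in> bounded_ultrafilters A I. a \<in> u}))"

definition Theta_embedding :: "'a set set \<Rightarrow> 'a \<Rightarrow> 'a set set" where
  "Theta_embedding A x = {F \<in> A. x \<in> F}"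

definition beta0 :: "'a topology \<Rightarrow> ('a set set \<times> 'a set set) \<Rightarrow> 'a ext set" where
  "beta0 X = (\<lambda>(A, I). ext_equiv X `` {(Theta A I, Theta_embedding A)})"

text \<open>
  A local proximity space on a fixed set \<open>\<Omega>\<close> is encoded as a pair \<open>(\<delta>, \<B>)\<close>, with the relation
  \<open>\<delta>\<close> on \<open>Pow \<Omega>\<close> given by its graph.
\<close>

type_synonym 'a prox = "('a set \<times> 'a set) set \<times> 'a set set"

text \<open>\<open>strongly_in \<Omega> \<delta> D E\<close> is \<open>D \<lless> E\<close>.\<close>

definition strongly_in :: "'a set \<Rightarrow> ('a set \<times> 'a set) set \<Rightarrow> 'a set \<Rightarrow> 'a set \<Rightarrow> bool" where
  "strongly_in \<Omega> \<delta> D E \<longleftrightarrow> (D, \<Omega> - E) \<notin> \<delta>"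

definition local_proximity ::
  "'a set \<Rightarrow> ('a set \<times> 'a set) set \<Rightarrow> 'a set set \<Rightarrow> bool" where
  "local_proximity \<Omega> \<delta> \<B> \<longleftrightarrow>
     \<B> \<in> Idl (Pow \<Omega>) \<and>
     \<delta> \<subseteq> Pow \<Omega> \<times> Pow \<Omega> \<and> sym \<delta> \<and>
     (\<forall>A. A \<subseteq> \<Omega> \<longrightarrow> ({}, A) \<notin> \<delta>) \<and>
     (\<forall>A. A \<subseteq> \<Omega> \<longrightarrow> A \<noteq> {} \<longrightarrow> (A, A) \<in> \<delta>) \<and>
     (\<forall>A B C. A \<subseteq> \<Omega> \<longrightarrow> B \<subseteq> \<Omega> \<longrightarrow> C \<subseteq> \<Omega> \<longrightarrow>
        ((A, B \<union> C) \<in> \<delta> \<longleftrightarrow> (A, B) \<in> \<delta> \<or> (A, C) \<in> \<delta>)) \<and>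
     (\<forall>A C. A \<in> \<B> \<longrightarrow> C \<subseteq> \<Omega> \<longrightarrow> strongly_in \<Omega> \<delta> A C \<longrightarrow>
        (\<exists>B \<in> \<B>. strongly_in \<Omega> \<delta> A B \<and> strongly_in \<Omega> \<delta> B C)) \<and>
     (\<forall>A C. (A, C) \<in> \<delta> \<longrightarrow> (\<exists>B \<in> \<B>. B \<subseteq> C \<and> (A, B) \<in> \<delta>))"

definition separated_prox :: "'a set \<Rightarrow> ('a set \<times> 'a set) set \<Rightarrow> bool" where
  "separated_prox \<Omega> \<delta> \<longleftrightarrow> (\<forall>x \<in> \<Omega>. \<forall>y \<in> \<Omega>. ({x}, {y}) \<in> \<delta> \<longleftrightarrow> x = y)"

definition LP :: "'a topology \<Rightarrow> 'a prox set" where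
  "LP X = {(\<delta>, \<B>). local_proximity (topspace X) \<delta> \<B> \<and> separated_prox (topspace X) \<delta> \<and>
     (\<forall>M. M \<subseteq> topspace X \<longrightarrow> X closure_of M = {x \<in> topspace X. ({x}, M) \<in> \<delta>})}"

definition zero_dimensional_prox ::
  "'a set \<Rightarrow> ('a set \<times> 'a set) set \<Rightarrow> 'a set set \<Rightarrow> bool" where
  "zero_dimensional_prox \<Omega> \<delta> \<B> \<longleftrightarrow>
     (\<forall>A \<in> \<B>. \<forall>B \<in> \<B>. strongly_in \<Omega> \<delta> A B \<longrightarrow>
        (\<exists>C. C \<subseteq> \<Omega> \<and> A \<subseteq> C \<and> C \<subseteq> B \<and> strongly_in \<Omega> \<delta> C C))"

definition LP0 :: "'a topology \<Rightarrow> 'a prox set" where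
  "LP0 X = {(\<delta>, \<B>) \<in> LP X. zero_dimensional_prox (topspace X) \<delta> \<B>}"

definition LP_le :: "'a prox \<Rightarrow> 'a prox \<Rightarrow> bool" where
  "LP_le = (\<lambda>(\<beta>1, \<B>1) (\<beta>2, \<B>2). \<beta>2 \<subseteq> \<beta>1 \<and> \<B>2 \<subseteq> \<B>1)"

definition ext_prox :: "'a topology \<Rightarrow> ('b topology \<times> ('a \<Rightarrow> 'b)) \<Rightarrow> 'a prox" where
  "ext_prox X = (\<lambda>(Y, f).
     ({(M, N). M \<subseteq> topspace X \<and> N \<subseteq> topspace X \<and> Y closure_of (f ` M) \<inter> Y closure_of (f ` N) \<noteq> {}},
      {M. M \<subseteq> topspace X \<and> compactin Y (Y closure_of (f ` M))}))"

text \<open>Equivalent extensions have the same \<open>ext_prox\<close>, so the image below is a singleton.\<close>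

definition Leader_map :: "'a topology \<Rightarrow> 'a ext set \<Rightarrow> 'a prox" where
  "Leader_map X c = the_elem (ext_prox X ` c)"

definition Leader_inv :: "'a topology \<Rightarrow> 'a prox \<Rightarrow> 'a ext set" where
  "Leader_inv X = inv_into (lc_hausdorff_ext_classes X) (Leader_map X)"

definition prox_of_alg :: "'a topology \<Rightarrow> ('a set set \<times> 'a set set) \<Rightarrow> 'a prox" where
  "prox_of_alg X = (\<lambda>(A, I).
     let \<B> = {M. M \<subseteq> topspace X \<and> (\<exists>B \<in> I. M \<subseteq> B)};
         near = (\<lambda>M N. \<forall>F \<in> I. M \<subseteq> F \<longrightarrow> F \<inter> N \<noteq> {})
     in ({(K, L). K \<subseteq> topspace X \<and> L \<subseteq> topspace X \<and>
            (\<exists>M \<in> \<B>. \<exists>N \<in> \<B>. M \<subseteq> K \<and> N \<subseteq> L \<and> near M N)}, \<B>))"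

definition alg_of_prox :: "'a topology \<Rightarrow> 'a prox \<Rightarrow> ('a set set \<times> 'a set set)" where
  "alg_of_prox X = (\<lambda>(\<delta>, \<B>).
     let A = {F. F \<subseteq> topspace X \<and> strongly_in (topspace X) \<delta> F F} in (A, A \<inter> \<B>))"

definition is_poset :: "'a set \<Rightarrow> ('a \<Rightarrow> 'a \<Rightarrow> bool) \<Rightarrow> bool" where
  "is_poset P r \<longleftrightarrow> reflp_on P r \<and> transp_on P r \<and> antisymp_on P r"

definition poset_isomorphism ::
  "'a set \<Rightarrow> ('a \<Rightarrow> 'a \<Rightarrow> bool) \<Rightarrow> 'b set \<Rightarrow> ('b \<Rightarrow> 'b \<Rightarrow> bool) \<Rightarrow> ('a \<Rightarrow> 'b) \<Rightarrow> bool" where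
  "poset_isomorphism P r Q s f \<longleftrightarrow> is_poset P r \<and> is_poset Q s \<and> bij_betw f P Q \<and>
     (\<forall>p \<in> P. \<forall>q \<in> P. r p q \<longleftrightarrow> s (f p) (f q))"

end

(*
  Both sides are governed by one separation property: for bounded K, the sets K and L are far iff
  some F in I contains K and misses L. For the proximity of (A, I) it holds by construction, and
  for a zero-dimensional proximity it combines (BC1) with the clopen interpolant. It shows that
  L_X and l_X are mutually inverse. The condition on simple ideals enters only in recovering A: if
  F << F, the members of I inside F form a simple ideal, and its join in A is F.
  Bounded ultrafilters of A whose members all meet M are the closure points of M in Theta(A, I), so
  by compactness Theta(A, I) induces the proximity of (A, I). Any locally compact Hausdorff
  extension Y inducing it is homeomorphic to Theta(A, I), which replaces Leader's theorem here.
*)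
theory Submission
  imports Defs
begin

text \<open>The members of I cover X, but X itself may lie outside I, so separation cannot be tested
  by a single member of I once the sets are unbounded. Every statement about arbitrary subsets is
  therefore localised to a G in I.

  In localised form, F << F says that F traces a member of I on each G in I. The sets F with this
  property form the largest algebra of subsets of X in which I is an ideal. The proximity is built
  from I alone, so the way back can only return this largest algebra; the condition on joins is
  exactly what forces A to be that large. A priori the union of a simple ideal need not belong to A,
  which is why its join in A has to be compared with the union by a separate argument.\<close>

lemma extension_image_subset:
  assumes "(Y, f) \<in> extensions X"
  shows "f ` topspace X \<subseteq> topspace Y"
proof -
  have "embedding_map X Y f" using assms unfolding extensions_def by simp
  then have "continuous_map X Y f"
    by (metis embedding_map_def homeomorphic_imp_continuous_map continuous_map_in_subtopology)
  then show ?thesis unfolding continuous_map_def by blast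
qed


section \<open>Ideals in lattices of sets\<close>

lemma IdlI:
  assumes "J \<subseteq> D" "{} \<in> J" "\<And>a b. a \<in> J \<Longrightarrow> b \<in> D \<Longrightarrow> b \<subseteq> a \<Longrightarrow> b \<in> J"
    "\<And>a b. a \<in> J \<Longrightarrow> b \<in> J \<Longrightarrow> a \<union> b \<in> J"
  shows "J \<in> Idl D"
  using assms unfolding Idl_def by simp

lemma Idl_subset: "J \<in> Idl D \<Longrightarrow> a \<in> J \<Longrightarrow> a \<in> D"
  unfolding Idl_def by blast

lemma Idl_empty: "J \<in> Idl D \<Longrightarrow> {} \<in> J"
  unfolding Idl_def by blast

lemma Idl_down: "J \<in> Idl D \<Longrightarrow> a \<in> J \<Longrightarrow> b \<in> D \<Longrightarrow> b \<subseteq> a \<Longrightarrow> b \<in> J"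
  unfolding Idl_def by simp

lemma Idl_Un: "J \<in> Idl D \<Longrightarrow> a \<in> J \<Longrightarrow> b \<in> J \<Longrightarrow> a \<union> b \<in> J"
  unfolding Idl_def by simp

lemma Idl_Join_upper: "J \<in> \<J> \<Longrightarrow> J \<subseteq> Idl_Join D \<J>"
  unfolding Idl_Join_def by (rule Inter_greatest) simp

lemma Idl_Join_least: "K \<in> Idl D \<Longrightarrow> (\<And>J. J \<in> \<J> \<Longrightarrow> J \<subseteq> K) \<Longrightarrow> Idl_Join D \<J> \<subseteq> K"
  unfolding Idl_Join_def by (rule Inter_lower) simp

lemma Idl_annihilator:
  assumes "{} \<in> D" "\<And>a b. a \<in> D \<Longrightarrow> b \<in> D \<Longrightarrow> a \<union> b \<in> D"
  shows "{d \<in> D. \<forall>a \<in> J. d \<inter> a = {}} \<in> Idl D"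
  using assms by (intro IdlI) (auto, blast+)

text \<open>The pseudocomplement in the frame of ideals is the annihilator. If K meets J only in the
  empty set, then for d in K and a in J the set \<open>d \<inter> a\<close> lies below both and
  hence in \<open>K \<inter> J\<close>, so it is empty.\<close>

lemma Idl_neg_eq:
  assumes "{} \<in> D" and un: "\<And>a b. a \<in> D \<Longrightarrow> b \<in> D \<Longrightarrow> a \<union> b \<in> D"
    and int: "\<And>a b. a \<in> D \<Longrightarrow> b \<in> D \<Longrightarrow> a \<inter> b \<in> D" and J: "J \<in> Idl D"
  shows "Idl_neg D J = {d \<in> D. \<forall>a \<in> J. d \<inter> a = {}}" (is "_ = ?N")
proof
  have N: "?N \<in> Idl D"
    using assms(1) un by (rule Idl_annihilator)
  have "K \<subseteq> ?N" if "K \<in> Idl D" "K \<inter> J = {{}}" for K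
  proof
    fix d assume d: "d \<in> K"
    have "d \<inter> a = {}" if a: "a \<in> J" for a
    proof -
      have "d \<inter> a \<in> D" using int d a J \<open>K \<in> Idl D\<close> by (simp add: Idl_subset)
      then have "d \<inter> a \<in> K" "d \<inter> a \<in> J"
        using Idl_down[OF \<open>K \<in> Idl D\<close> d] Idl_down[OF J a] by auto
      then have "d \<inter> a \<in> K \<inter> J" by (rule IntI)
      then show ?thesis using \<open>K \<inter> J = {{}}\<close> by simp
    qed
    then show "d \<in> ?N" using d \<open>K \<in> Idl D\<close> by (simp add: Idl_subset)
  qed
  then show "Idl_neg D J \<subseteq> ?N"
    unfolding Idl_neg_def by (intro Idl_Join_least[OF N]) simp
  have "?N \<inter> J = {{}}"
  proof
    show "?N \<inter> J \<subseteq> {{}}" by blast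
    show "{{}} \<subseteq> ?N \<inter> J" using N J assms(1) by (simp add: Idl_empty)
  qed
  then show "?N \<subseteq> Idl_neg D J"
    unfolding Idl_neg_def using N by (intro Idl_Join_upper) simp
qed

text \<open>Distributivity keeps the family of unions downward closed: a member d of D below
  \<open>a \<union> b\<close> splits as the union of \<open>d \<inter> a\<close> and
  \<open>d \<inter> b\<close>.\<close>

lemma Idl_Join_pair:
  assumes un: "\<And>a b. a \<in> D \<Longrightarrow> b \<in> D \<Longrightarrow> a \<union> b \<in> D"
    and int: "\<And>a b. a \<in> D \<Longrightarrow> b \<in> D \<Longrightarrow> a \<inter> b \<in> D"
    and J: "J \<in> Idl D" and K: "K \<in> Idl D"
  shows "Idl_Join D {J, K} = {a \<union> b |a b. a \<in> J \<and> b \<in> K}" (is "_ = ?S")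
proof
  have "?S \<in> Idl D"
  proof (rule IdlI)
    show "?S \<subseteq> D" using Idl_subset[OF J] Idl_subset[OF K] un by blast
    show "{} \<in> ?S" using Idl_empty[OF J] Idl_empty[OF K] by blast
    fix s assume "s \<in> ?S"
    then obtain a b where s: "s = a \<union> b" "a \<in> J" "b \<in> K" by blast
    show "d \<in> ?S" if d: "d \<in> D" "d \<subseteq> s" for d
    proof -
      have "d \<inter> a \<in> J" "d \<inter> b \<in> K"
        using Idl_down[OF J s(2)] Idl_down[OF K s(3)] Idl_subset[OF J s(2)] Idl_subset[OF K s(3)]
          d(1) int by auto
      moreover have "d = (d \<inter> a) \<union> (d \<inter> b)" using s d by blast
      ultimately show ?thesis by blast
    qed
    show "s \<union> t \<in> ?S" if tS: "t \<in> ?S" for t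
    proof -
      obtain a' b' where t: "t = a' \<union> b'" "a' \<in> J" "b' \<in> K" using tS by blast
      have "s \<union> t = (a \<union> a') \<union> (b \<union> b')" using s t by blast
      moreover have "a \<union> a' \<in> J" "b \<union> b' \<in> K"
        using s t Idl_Un[OF J] Idl_Un[OF K] by simp_all
      ultimately show ?thesis by blast
    qed
  qed
  moreover have "a \<in> ?S" if "a \<in> J" for a
    using that Idl_empty[OF K] by (metis (mono_tags, lifting) mem_Collect_eq sup_bot.right_neutral)
  moreover have "b \<in> ?S" if "b \<in> K" for b
    using that Idl_empty[OF J] by (metis (mono_tags, lifting) mem_Collect_eq sup_bot.left_neutral)
  ultimately have "?S \<in> {L \<in> Idl D. \<forall>M \<in> {J, K}. M \<subseteq> L}" by simp blast
  then show "Idl_Join D {J, K} \<subseteq> ?S" unfolding Idl_Join_def by (rule Inter_lower)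
  show "?S \<subseteq> Idl_Join D {J, K}"
  proof
    fix s assume "s \<in> ?S"
    then obtain a b where s: "s = a \<union> b" "a \<in> J" "b \<in> K" by blast
    have "s \<in> L" if L: "L \<in> Idl D" "J \<subseteq> L" "K \<subseteq> L" for L
      unfolding s(1) using L(2,3) s(2,3) by (intro Idl_Un[OF L(1)]) auto
    then show "s \<in> Idl_Join D {J, K}" unfolding Idl_Join_def by simp
  qed
qed

text \<open>With join and pseudocomplement explicit, simplicity becomes a splitting property of
  single members of D: each is cut by J into a part in J and a remainder annihilated by J. Later
  arguments use simplicity only in this form.\<close>

lemma simple_ideal_iff:
  assumes "{} \<in> D" "\<And>a b. a \<in> D \<Longrightarrow> b \<in> D \<Longrightarrow> a \<union> b \<in> D"
    "\<And>a b. a \<in> D \<Longrightarrow> b \<in> D \<Longrightarrow> a \<inter> b \<in> D"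
  shows "simple_ideal D J \<longleftrightarrow>
    J \<in> Idl D \<and> (\<forall>d \<in> D. \<exists>a \<in> J. \<exists>b \<in> D. d = a \<union> b \<and> (\<forall>c \<in> J. b \<inter> c = {}))"
proof (cases "J \<in> Idl D")
  case True
  let ?N = "{d \<in> D. \<forall>a \<in> J. d \<inter> a = {}}"
  have "?N \<in> Idl D"
    using assms(1,2) by (rule Idl_annihilator)
  then have "Idl_Join D {J, Idl_neg D J} = {a \<union> b |a b. a \<in> J \<and> b \<in> ?N}"
    using Idl_neg_eq[OF assms True] Idl_Join_pair[OF assms(2,3) True] by simp
  moreover have "J \<subseteq> D" using Idl_subset[OF True] by blast
  then have "{a \<union> b |a b. a \<in> J \<and> b \<in> ?N} \<subseteq> D"
    using assms(2) by blast
  ultimately have "simple_ideal D J \<longleftrightarrow> D \<subseteq> {a \<union> b |a b. a \<in> J \<and> b \<in> ?N}"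
    using True unfolding simple_ideal_def by (metis (no_types, lifting) equalityE equalityI)
  also have "\<dots> \<longleftrightarrow> (\<forall>d \<in> D. \<exists>a \<in> J. \<exists>b \<in> D. d = a \<union> b \<and> (\<forall>c \<in> J. b \<inter> c = {}))"
    unfolding subset_iff mem_Collect_eq Bex_def by meson
  finally show ?thesis using True by simp
qed (simp add: simple_ideal_def)


section \<open>Algebras of clopen sets with an ideal that is a base\<close>

text \<open>Weaker than membership in \<open>ZA X\<close>: the pair built from a proximity enters
  here first, and its density and joins are then proved with the lemmas of this context.\<close>

locale admissible_pair = algebra "topspace X" A
  for X :: "'a topology" and A :: "'a set set" +
  fixes I :: "'a set set"
  assumes ideal: "I \<in> Idl A" and clopen: "A \<subseteq> clopens X" and base: "open_base X I"
begin

lemma I_in_A: "F \<in> I \<Longrightarrow> F \<in> A"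
  using Idl_subset[OF ideal] .

lemma I_empty: "{} \<in> I"
  using Idl_empty[OF ideal] .

lemma I_down: "F \<in> I \<Longrightarrow> G \<in> A \<Longrightarrow> G \<subseteq> F \<Longrightarrow> G \<in> I"
  using Idl_down[OF ideal] .

lemma I_Un: "F \<in> I \<Longrightarrow> G \<in> I \<Longrightarrow> F \<union> G \<in> I"
  using Idl_Un[OF ideal] .

lemma I_Int1: "F \<in> I \<Longrightarrow> G \<in> A \<Longrightarrow> F \<inter> G \<in> I"
  by (meson I_down I_in_A Int Int_lower1)

lemma I_Int: "F \<in> I \<Longrightarrow> G \<in> I \<Longrightarrow> F \<inter> G \<in> I"
  by (rule I_Int1[OF _ I_in_A])

lemma simple_ideal_I_iff:
  "simple_ideal I J \<longleftrightarrow>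
    J \<in> Idl I \<and> (\<forall>d \<in> I. \<exists>a \<in> J. \<exists>b \<in> I. d = a \<union> b \<and> (\<forall>c \<in> J. b \<inter> c = {}))"
  by (rule simple_ideal_iff) (simp_all add: I_empty I_Un I_Int)

lemma I_Int2: "F \<in> A \<Longrightarrow> G \<in> I \<Longrightarrow> F \<inter> G \<in> I"
  by (meson I_down I_in_A Int Int_lower2)

lemma I_Diff: "F \<in> I \<Longrightarrow> G \<in> A \<Longrightarrow> F - G \<in> I"
  by (meson I_down I_in_A Diff Diff_subset)

lemma I_UN: "finite S \<Longrightarrow> S \<subseteq> I \<Longrightarrow> \<Union>S \<in> I"
  by (induction rule: finite_induct) (auto simp: I_empty I_Un)

lemma A_openin: "F \<in> A \<Longrightarrow> openin X F"
  using clopen unfolding clopens_def by blast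

lemma A_subset: "F \<in> A \<Longrightarrow> F \<subseteq> topspace X"
  using sets_into_space .

lemma base_obtain:
  assumes "openin X U" "x \<in> U"
  obtains F where "F \<in> I" "x \<in> F" "F \<subseteq> U"
proof -
  have "\<exists>F. F \<in> I \<and> x \<in> F \<and> F \<subseteq> U"
    using base assms unfolding open_base_def openin_topology_base_unique by meson
  then show thesis using that by blast
qed

lemma I_covers:
  assumes "x \<in> topspace X"
  obtains F where "F \<in> I" "x \<in> F"
  using base_obtain[OF openin_topspace assms] that by metis

lemma in_closure_of_iff:
  "x \<in> X closure_of M \<longleftrightarrow> x \<in> topspace X \<and> (\<forall>F \<in> I. x \<in> F \<longrightarrow> F \<inter> M \<noteq> {})"
proof safe
  fix F assume "x \<in> X closure_of M" "F \<in> I" "x \<in> F" "F \<inter> M = {}"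
  then show False
    using A_openin[OF I_in_A] unfolding in_closure_of by blast
next
  assume "x \<in> topspace X" "\<forall>F \<in> I. x \<in> F \<longrightarrow> F \<inter> M \<noteq> {}"
  then show "x \<in> X closure_of M"
    unfolding in_closure_of by (metis base_obtain Int_iff all_not_in_conv subsetD)
qed (simp add: in_closure_of)

section \<open>The local proximity of an admissible pair\<close>

abbreviation prox :: "('a set \<times> 'a set) set" where
  "prox \<equiv> fst (prox_of_alg X (A, I))"

abbreviation bounded_sets :: "'a set set" where
  "bounded_sets \<equiv> snd (prox_of_alg X (A, I))"

lemma bounded_sets_iff: "M \<in> bounded_sets \<longleftrightarrow> (\<exists>F \<in> I. M \<subseteq> F)"
  unfolding prox_of_alg_def Let_def using A_subset[OF I_in_A] by auto

text \<open>Localises the definition, which quantifies over pairs of bounded sets. For given G, the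
  pair \<open>K \<inter> G\<close>, \<open>L \<inter> G\<close> is bounded, and a separating F cut
  down to G misses all of L. Conversely, a bounded pair M, N is separated by applying the condition
  to a member of I that contains M.\<close>

lemma far_iff:
  assumes "K \<subseteq> topspace X" "L \<subseteq> topspace X"
  shows "(K, L) \<notin> prox \<longleftrightarrow> (\<forall>G \<in> I. \<exists>F \<in> I. F \<subseteq> G \<and> K \<inter> G \<subseteq> F \<and> F \<inter> L = {})"
proof
  assume far: "(K, L) \<notin> prox"
  show "\<forall>G \<in> I. \<exists>F \<in> I. F \<subseteq> G \<and> K \<inter> G \<subseteq> F \<and> F \<inter> L = {}"
  proof
    fix G assume G: "G \<in> I"
    have "\<exists>F \<in> I. K \<inter> G \<subseteq> F \<and> F \<inter> (L \<inter> G) = {}"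
    proof (rule ccontr)
      assume "\<not> ?thesis"
      moreover have "K \<inter> G \<subseteq> topspace X" "L \<inter> G \<subseteq> topspace X" using assms by blast+
      ultimately have "(K, L) \<in> prox"
        using G assms unfolding prox_of_alg_def Let_def
        by simp (metis Int_lower1 Int_lower2)
      then show False using far by simp
    qed
    then obtain F where "F \<in> I" "K \<inter> G \<subseteq> F" "F \<inter> (L \<inter> G) = {}" by blast
    then show "\<exists>F \<in> I. F \<subseteq> G \<and> K \<inter> G \<subseteq> F \<and> F \<inter> L = {}"
      using G by (intro bexI[of _ "F \<inter> G"]) (auto intro: I_Int1 I_in_A)
  qed
next
  assume *: "\<forall>G \<in> I. \<exists>F \<in> I. F \<subseteq> G \<and> K \<inter> G \<subseteq> F \<and> F \<inter> L = {}"
  show "(K, L) \<notin> prox"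
  proof
    assume "(K, L) \<in> prox"
    then obtain M N B C where MN: "M \<subseteq> K" "N \<subseteq> L" "B \<in> I" "M \<subseteq> B" "C \<in> I" "N \<subseteq> C"
      and near: "\<forall>F \<in> I. M \<subseteq> F \<longrightarrow> F \<inter> N \<noteq> {}"
      unfolding prox_of_alg_def Let_def by auto
    obtain F where "F \<in> I" "K \<inter> B \<subseteq> F" "F \<inter> L = {}"
      using bspec[OF * MN(3)] by blast
    moreover have "M \<subseteq> F" "F \<inter> N = {}" using calculation MN by blast+
    ultimately show False using near by blast
  qed
qed

lemma farE:
  assumes "(K, L) \<notin> prox" "K \<subseteq> topspace X" "L \<subseteq> topspace X" "G \<in> I"
  obtains F where "F \<in> I" "F \<subseteq> G" "K \<inter> G \<subseteq> F" "F \<inter> L = {}"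
  using assms far_iff[OF assms(2,3)] that by meson

lemma prox_subset: "(K, L) \<in> prox \<Longrightarrow> K \<subseteq> topspace X \<and> L \<subseteq> topspace X"
  unfolding prox_of_alg_def Let_def by auto

lemma far_mono:
  assumes "(K, L) \<notin> prox" "K' \<subseteq> K" "L' \<subseteq> L" "K \<subseteq> topspace X" "L \<subseteq> topspace X"
  shows "(K', L') \<notin> prox"
proof -
  have "K' \<subseteq> topspace X" "L' \<subseteq> topspace X" using assms by blast+
  moreover have "\<exists>F \<in> I. F \<subseteq> G \<and> K' \<inter> G \<subseteq> F \<and> F \<inter> L' = {}" if G: "G \<in> I" for G
  proof -
    obtain F where "F \<in> I" "F \<subseteq> G" "K \<inter> G \<subseteq> F" "F \<inter> L = {}"
      using farE[OF assms(1,4,5) G] .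
    then show ?thesis using assms by (intro bexI[of _ F]) auto
  qed
  ultimately show ?thesis using far_iff by blast
qed

text \<open>Complementation inside G exchanges the roles: if F contains \<open>K \<inter> G\<close>
  and misses L, then \<open>G - F\<close> contains \<open>L \<inter> G\<close> and misses K.\<close>

lemma far_sym:
  assumes "(K, L) \<notin> prox" shows "(L, K) \<notin> prox"
proof
  assume near: "(L, K) \<in> prox"
  then have sub: "K \<subseteq> topspace X" "L \<subseteq> topspace X" using prox_subset by blast+
  have "\<exists>F \<in> I. F \<subseteq> G \<and> L \<inter> G \<subseteq> F \<and> F \<inter> K = {}" if G: "G \<in> I" for G
  proof -
    obtain F where "F \<in> I" "F \<subseteq> G" "K \<inter> G \<subseteq> F" "F \<inter> L = {}"
      using farE[OF assms sub G] .
    then show ?thesis using G by (intro bexI[of _ "G - F"]) (auto intro: I_Diff I_in_A)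
  qed
  then show False using near sub far_iff by blast
qed

text \<open>On each G in I the separating set is the trace of F on G, a member of I because I is an
  ideal of A.\<close>

lemma A_strongly:
  assumes "F \<in> A" shows "(F, topspace X - F) \<notin> prox"
proof (subst far_iff)
  show "\<forall>G \<in> I. \<exists>H \<in> I. H \<subseteq> G \<and> F \<inter> G \<subseteq> H \<and> H \<inter> (topspace X - F) = {}"
    using I_Int2[OF assms] by (metis Diff_disjoint Int_assoc Int_commute Int_empty_right Int_lower2 order_refl)
qed (use A_subset[OF assms] in auto)

text \<open>A bounded K lies in a single G, so the separation local to that G is already
  global.\<close>

lemma far_separation:
  assumes "(K, L) \<notin> prox" "K \<in> bounded_sets" "K \<subseteq> topspace X" "L \<subseteq> topspace X"
  obtains F where "F \<in> I" "K \<subseteq> F" "F \<inter> L = {}"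
proof -
  obtain G where "G \<in> I" "K \<subseteq> G" using assms bounded_sets_iff by blast
  then show thesis using farE[OF assms(1,3,4)] that by (metis inf.absorb1)
qed

lemma bounded_far_iff:
  assumes "K \<in> bounded_sets" "K \<subseteq> topspace X" "L \<subseteq> topspace X"
  shows "(K, L) \<notin> prox \<longleftrightarrow> (\<exists>F \<in> I. K \<subseteq> F \<and> F \<inter> L = {})"
proof
  assume "\<exists>F \<in> I. K \<subseteq> F \<and> F \<inter> L = {}"
  then obtain F where F: "F \<in> I" "K \<subseteq> F" "F \<inter> L = {}" by blast
  then have "L \<subseteq> topspace X - F" using assms by blast
  then show "(K, L) \<notin> prox"
    using far_mono[OF A_strongly[OF I_in_A] F(2)] F A_subset I_in_A by blast
next
  assume "(K, L) \<notin> prox"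
  then show "\<exists>F \<in> I. K \<subseteq> F \<and> F \<inter> L = {}"
    using assms by (metis far_separation)
qed

lemma local_proximity_prox: "local_proximity (topspace X) prox bounded_sets"
  unfolding local_proximity_def
proof (intro conjI allI impI)
  show "bounded_sets \<in> Idl (Pow (topspace X))"
    unfolding Idl_def
  proof (intro CollectI conjI ballI impI)
    show "bounded_sets \<subseteq> Pow (topspace X)"
      using bounded_sets_iff A_subset[OF I_in_A] by blast
    show "{} \<in> bounded_sets" using bounded_sets_iff I_empty by blast
    show "b \<in> bounded_sets" if "a \<in> bounded_sets" "b \<subseteq> a" for a b
      using that unfolding bounded_sets_iff by blast
    show "a \<union> b \<in> bounded_sets" if "a \<in> bounded_sets" "b \<in> bounded_sets" for a b
      using that I_Un unfolding bounded_sets_iff by (meson Un_mono)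
  qed
  show "prox \<subseteq> Pow (topspace X) \<times> Pow (topspace X)"
    using prox_subset by auto
  show "sym prox" by (meson symI far_sym)
next
  fix K assume K: "K \<subseteq> topspace X"
  show "({}, K) \<notin> prox"
    using K I_empty by (subst far_iff) auto
  assume "K \<noteq> {}"
  then obtain x G where x: "x \<in> K" "G \<in> I" "x \<in> G" using K I_covers by (metis ex_in_conv subsetD)
  show "(K, K) \<in> prox"
  proof (rule ccontr)
    assume "(K, K) \<notin> prox"
    then obtain F where "F \<in> I" "K \<inter> G \<subseteq> F" "F \<inter> K = {}"
      using farE K x(2) by metis
    then show False using x by blast
  qed
next
  fix K L M assume sub: "K \<subseteq> topspace X" "L \<subseteq> topspace X" "M \<subseteq> topspace X"
  show "(K, L \<union> M) \<in> prox \<longleftrightarrow> (K, L) \<in> prox \<or> (K, M) \<in> prox"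
  proof
    assume near: "(K, L \<union> M) \<in> prox"
    show "(K, L) \<in> prox \<or> (K, M) \<in> prox"
    proof (rule ccontr)
      assume "\<not> ?thesis"
      then have far: "(K, L) \<notin> prox" "(K, M) \<notin> prox" by blast+
      have "\<exists>F \<in> I. F \<subseteq> G \<and> K \<inter> G \<subseteq> F \<and> F \<inter> (L \<union> M) = {}" if G: "G \<in> I" for G
      proof -
        obtain F where F: "F \<in> I" "F \<subseteq> G" "K \<inter> G \<subseteq> F" "F \<inter> L = {}"
          using farE[OF far(1) sub(1,2) G] .
        obtain F' where F': "F' \<in> I" "F' \<subseteq> G" "K \<inter> G \<subseteq> F'" "F' \<inter> M = {}"
          using farE[OF far(2) sub(1,3) G] .
        show ?thesis
          using F F' by (intro bexI[of _ "F \<inter> F'"]) (auto intro: I_Int1 I_in_A)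
      qed
      then show False using near sub far_iff[of K "L \<union> M"] by blast
    qed
  next
    assume "(K, L) \<in> prox \<or> (K, M) \<in> prox"
    then show "(K, L \<union> M) \<in> prox"
      using far_mono[of K "L \<union> M"] sub by (meson Un_least Un_upper1 Un_upper2 order_refl)
  qed
next
  fix K C assume K: "K \<in> bounded_sets" and C: "C \<subseteq> topspace X"
    and str: "strongly_in (topspace X) prox K C"
  obtain G where G: "G \<in> I" "K \<subseteq> G" using K bounded_sets_iff by blast
  have subK: "K \<subseteq> topspace X" using G A_subset I_in_A by blast
  \<comment> \<open>(BC1): the separating F is itself bounded and far from its own complement, so it
    can serve as the interpolant on both sides.\<close>
  obtain F where F: "F \<in> I" "K \<subseteq> F" "F \<inter> (topspace X - C) = {}"
    using far_separation str K subK unfolding strongly_in_def by blast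
  have FF: "(F, topspace X - F) \<notin> prox" using A_strongly I_in_A F by blast
  have sub: "F \<subseteq> topspace X" using F A_subset I_in_A by blast
  show "\<exists>B \<in> bounded_sets. strongly_in (topspace X) prox K B \<and> strongly_in (topspace X) prox B C"
  proof (intro bexI[of _ F] conjI)
    show "F \<in> bounded_sets" using bounded_sets_iff F by blast
    show "strongly_in (topspace X) prox K F"
      unfolding strongly_in_def using far_mono[OF FF] F sub by blast
    have "topspace X - C \<subseteq> topspace X - F" using F by blast
    then show "strongly_in (topspace X) prox F C"
      unfolding strongly_in_def using far_mono[OF FF] F sub by blast
  qed
next
  fix K C assume near: "(K, C) \<in> prox"
  then have sub: "K \<subseteq> topspace X" "C \<subseteq> topspace X" using prox_subset by blast+
  \<comment> \<open>(BC2): a G on which no separation exists makes \<open>C \<inter> G\<close> the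
    bounded subset, since the sets F tested on G lie inside G and meet C only there.\<close>
  obtain G where G: "G \<in> I" "\<forall>F \<in> I. F \<subseteq> G \<longrightarrow> K \<inter> G \<subseteq> F \<longrightarrow> F \<inter> C \<noteq> {}"
    using near sub far_iff by meson
  have "C \<inter> G \<in> bounded_sets" using G bounded_sets_iff by blast
  moreover have "(K, C \<inter> G) \<in> prox"
  proof (rule ccontr)
    assume "(K, C \<inter> G) \<notin> prox"
    moreover have "C \<inter> G \<subseteq> topspace X" using sub by blast
    ultimately obtain F where "F \<in> I" "F \<subseteq> G" "K \<inter> G \<subseteq> F" "F \<inter> (C \<inter> G) = {}"
      using farE[OF _ sub(1) _ G(1)] by metis
    then show False using G by (metis Int_absorb1 inf.absorb_iff1 inf_left_commute inf_commute)
  qed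
  ultimately show "\<exists>B \<in> bounded_sets. B \<subseteq> C \<and> (K, B) \<in> prox" by blast
qed

lemma zero_dimensional_prox: "zero_dimensional_prox (topspace X) prox bounded_sets"
  unfolding zero_dimensional_prox_def
proof (intro ballI impI)
  fix K L assume K: "K \<in> bounded_sets" and L: "L \<in> bounded_sets"
    and "strongly_in (topspace X) prox K L"
  then have far: "(K, topspace X - L) \<notin> prox" by (simp add: strongly_in_def)
  have "K \<subseteq> topspace X" using K bounded_sets_iff A_subset I_in_A by (meson order_trans)
  then obtain F where F: "F \<in> I" "K \<subseteq> F" "F \<inter> (topspace X - L) = {}"
    using far_separation[OF far K] by blast
  then have "F \<subseteq> topspace X" using A_subset I_in_A by blast
  then show "\<exists>C \<subseteq> topspace X. K \<subseteq> C \<and> C \<subseteq> L \<and> strongly_in (topspace X) prox C C"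
    using F A_strongly[OF I_in_A[OF F(1)]] unfolding strongly_in_def by blast
qed

text \<open>Points are bounded because I covers X. Hence a point is far from M iff some member of I
  contains it and misses M, and as I is a base this says that the point is outside the
  closure.\<close>

lemma prox_singleton_iff:
  assumes "M \<subseteq> topspace X"
  shows "x \<in> X closure_of M \<longleftrightarrow> x \<in> topspace X \<and> ({x}, M) \<in> prox"
proof (cases "x \<in> topspace X")
  case True
  then have "{x} \<in> bounded_sets" "{x} \<subseteq> topspace X"
    using bounded_sets_iff by (auto elim: I_covers)
  then show ?thesis
    using bounded_far_iff[OF _ _ assms, of "{x}"] True in_closure_of_iff[of x M] by blast
qed (simp add: in_closure_of)

lemma separated_prox:
  assumes "Hausdorff_space X"
  shows "separated_prox (topspace X) prox"
  unfolding separated_prox_def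
proof (intro ballI)
  fix x y assume xy: "x \<in> topspace X" "y \<in> topspace X"
  have "X closure_of {y} = {y}"
    using xy assms by (simp add: closedin_Hausdorff_singleton closure_of_closedin)
  then show "({x}, {y}) \<in> prox \<longleftrightarrow> x = y"
    using prox_singleton_iff[of "{y}" x] xy by auto
qed

lemma prox_of_alg_LP0:
  assumes "Hausdorff_space X"
  shows "prox_of_alg X (A, I) \<in> LP0 X"
proof -
  have "(prox, bounded_sets) \<in> LP0 X"
    using local_proximity_prox zero_dimensional_prox separated_prox[OF assms] prox_singleton_iff
    unfolding LP0_def LP_def by auto
  then show ?thesis by simp
qed

end

lemma ZA_admissible_pair:
  assumes "(A, I) \<in> ZA X" shows "admissible_pair X A I"
  using assms unfolding ZA_def ZLBA_def LBA_def admissible_pair_def admissible_pair_axioms_def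
  by blast


section \<open>Zero-dimensional local proximities\<close>

locale zero_dim_local_proximity =
  fixes X :: "'a topology" and \<delta> :: "('a set \<times> 'a set) set" and \<B> :: "'a set set"
  assumes LP0: "(\<delta>, \<B>) \<in> LP0 X"
begin

lemma lp: "local_proximity (topspace X) \<delta> \<B>"
  using LP0 unfolding LP0_def LP_def by simp

lemma bounded_ideal: "\<B> \<in> Idl (Pow (topspace X))"
  using lp unfolding local_proximity_def by simp

lemma bounded_subset: "M \<in> \<B> \<Longrightarrow> M \<subseteq> topspace X"
  using Idl_subset[OF bounded_ideal] by blast

lemma bounded_down: "M \<in> \<B> \<Longrightarrow> N \<subseteq> M \<Longrightarrow> N \<in> \<B>"
  using Idl_down[OF bounded_ideal, of M N] bounded_subset by blast

lemma near_subset: "(M, N) \<in> \<delta> \<Longrightarrow> M \<subseteq> topspace X \<and> N \<subseteq> topspace X"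
proof -
  have "\<delta> \<subseteq> Pow (topspace X) \<times> Pow (topspace X)"
    using lp unfolding local_proximity_def by (elim conjE)
  then show "(M, N) \<in> \<delta> \<Longrightarrow> M \<subseteq> topspace X \<and> N \<subseteq> topspace X" by blast
qed

lemma near_sym: "(M, N) \<in> \<delta> \<Longrightarrow> (N, M) \<in> \<delta>"
proof -
  have "sym \<delta>" using lp unfolding local_proximity_def by (elim conjE)
  then show "(M, N) \<in> \<delta> \<Longrightarrow> (N, M) \<in> \<delta>" by (rule symD)
qed

lemma far_empty: "M \<subseteq> topspace X \<Longrightarrow> ({}, M) \<notin> \<delta>"
  using lp unfolding local_proximity_def by simp

lemma near_refl: "M \<subseteq> topspace X \<Longrightarrow> M \<noteq> {} \<Longrightarrow> (M, M) \<in> \<delta>"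
  using lp unfolding local_proximity_def by simp

lemma near_Un:
  "K \<subseteq> topspace X \<Longrightarrow> M \<subseteq> topspace X \<Longrightarrow> N \<subseteq> topspace X \<Longrightarrow>
    (K, M \<union> N) \<in> \<delta> \<longleftrightarrow> (K, M) \<in> \<delta> \<or> (K, N) \<in> \<delta>"
  using lp unfolding local_proximity_def by simp

lemma BC1:
  assumes "M \<in> \<B>" "N \<subseteq> topspace X" "strongly_in (topspace X) \<delta> M N"
  obtains B where "B \<in> \<B>" "strongly_in (topspace X) \<delta> M B" "strongly_in (topspace X) \<delta> B N"
proof -
  have "\<forall>A C. A \<in> \<B> \<longrightarrow> C \<subseteq> topspace X \<longrightarrow> strongly_in (topspace X) \<delta> A C \<longrightarrow>
      (\<exists>B \<in> \<B>. strongly_in (topspace X) \<delta> A B \<and> strongly_in (topspace X) \<delta> B C)"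
    using lp unfolding local_proximity_def by (elim conjE)
  then show thesis using assms that by meson
qed

lemma BC2:
  assumes "(M, N) \<in> \<delta>"
  obtains B where "B \<in> \<B>" "B \<subseteq> N" "(M, B) \<in> \<delta>"
proof -
  have "\<forall>A C. (A, C) \<in> \<delta> \<longrightarrow> (\<exists>B \<in> \<B>. B \<subseteq> C \<and> (A, B) \<in> \<delta>)"
    using lp unfolding local_proximity_def by (elim conjE)
  then show thesis using assms that by meson
qed

lemma closure_iff:
  "M \<subseteq> topspace X \<Longrightarrow> X closure_of M = {x \<in> topspace X. ({x}, M) \<in> \<delta>}"
  using LP0 unfolding LP0_def LP_def by simp

lemma zero_dim:
  assumes "M \<in> \<B>" "N \<in> \<B>" "strongly_in (topspace X) \<delta> M N"
  obtains F where "F \<subseteq> topspace X" "M \<subseteq> F" "F \<subseteq> N" "strongly_in (topspace X) \<delta> F F"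
proof -
  have "zero_dimensional_prox (topspace X) \<delta> \<B>"
    using LP0 unfolding LP0_def by simp
  then show thesis
    using assms that unfolding zero_dimensional_prox_def by meson
qed

lemma near_mono_right:
  assumes "(M, N) \<in> \<delta>" "N \<subseteq> N'" "N' \<subseteq> topspace X"
  shows "(M, N') \<in> \<delta>"
  using near_Un[of M N N'] assms near_subset[OF assms(1)] by (simp add: Un_absorb1)

lemma near_mono:
  assumes "(M, N) \<in> \<delta>" "M \<subseteq> M'" "N \<subseteq> N'" "M' \<subseteq> topspace X" "N' \<subseteq> topspace X"
  shows "(M', N') \<in> \<delta>"
  using near_mono_right[OF near_sym[OF near_mono_right[OF assms(1,3,5)]] assms(2,4)]
  by (rule near_sym)

lemma far_disjoint:
  assumes "(M, N) \<notin> \<delta>" "M \<subseteq> topspace X" "N \<subseteq> topspace X"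
  shows "M \<inter> N = {}"
proof (rule ccontr)
  assume "M \<inter> N \<noteq> {}"
  moreover have "M \<inter> N \<subseteq> topspace X" using assms by blast
  ultimately have "(M \<inter> N, M \<inter> N) \<in> \<delta>" by (rule near_refl[rotated])
  then show False using near_mono[of "M \<inter> N" "M \<inter> N" M N] assms by simp
qed

section \<open>The algebra of a zero-dimensional local proximity\<close>

abbreviation clop :: "'a set set" where
  "clop \<equiv> fst (alg_of_prox X (\<delta>, \<B>))"

abbreviation bounded_clop :: "'a set set" where
  "bounded_clop \<equiv> snd (alg_of_prox X (\<delta>, \<B>))"

lemma clop_iff: "F \<in> clop \<longleftrightarrow> F \<subseteq> topspace X \<and> (F, topspace X - F) \<notin> \<delta>"
  unfolding alg_of_prox_def Let_def strongly_in_def by simp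

lemma bounded_clop_iff: "F \<in> bounded_clop \<longleftrightarrow> F \<in> clop \<and> F \<in> \<B>"
  unfolding alg_of_prox_def Let_def by simp

text \<open>Zero-dimensionality interpolates only between two bounded sets, and the complement of L
  may be unbounded. (BC1) therefore first supplies a bounded B between K and that complement. The
  clopen set F is found between K and B, and inherits boundedness from B.\<close>

lemma interpolation:
  assumes "K \<in> \<B>" "L \<subseteq> topspace X" "(K, L) \<notin> \<delta>"
  obtains F where "F \<in> bounded_clop" "K \<subseteq> F" "F \<inter> L = {}"
proof -
  have "strongly_in (topspace X) \<delta> K (topspace X - L)"
    using assms unfolding strongly_in_def by (simp add: double_diff)
  then obtain B where B: "B \<in> \<B>" "strongly_in (topspace X) \<delta> K B"
    "strongly_in (topspace X) \<delta> B (topspace X - L)"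
    using BC1[OF assms(1)] by (metis Diff_subset)
  then obtain F where F: "F \<subseteq> topspace X" "K \<subseteq> F" "F \<subseteq> B" "strongly_in (topspace X) \<delta> F F"
    using zero_dim[OF assms(1)] by blast
  have "(B, L) \<notin> \<delta>"
    using B(3) assms(2) unfolding strongly_in_def by (simp add: double_diff)
  then have "B \<inter> L = {}"
    using far_disjoint bounded_subset B(1) assms(2) by blast
  then show thesis
    using F bounded_down[OF B(1)] that[of F]
    unfolding bounded_clop_iff clop_iff strongly_in_def by blast
qed

lemma bounded_far_iff:
  assumes "K \<in> \<B>" "L \<subseteq> topspace X"
  shows "(K, L) \<notin> \<delta> \<longleftrightarrow> (\<exists>F \<in> bounded_clop. K \<subseteq> F \<and> F \<inter> L = {})"
proof
  assume "(K, L) \<notin> \<delta>"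
  then show "\<exists>F \<in> bounded_clop. K \<subseteq> F \<and> F \<inter> L = {}"
    by (metis interpolation assms)
next
  assume "\<exists>F \<in> bounded_clop. K \<subseteq> F \<and> F \<inter> L = {}"
  then obtain F where F: "F \<in> clop" "K \<subseteq> F" "F \<inter> L = {}"
    using bounded_clop_iff by blast
  then have "L \<subseteq> topspace X - F" using assms(2) by blast
  then show "(K, L) \<notin> \<delta>"
    using near_mono[of K L F "topspace X - F"] F unfolding clop_iff by blast
qed

text \<open>Interpolation against the empty set, which is far from everything.\<close>

lemma bounded_iff: "K \<in> \<B> \<longleftrightarrow> (\<exists>F \<in> bounded_clop. K \<subseteq> F)"
proof
  assume "K \<in> \<B>"
  moreover have "(K, {}) \<notin> \<delta>"
    using near_sym far_empty bounded_subset[OF \<open>K \<in> \<B>\<close>] by blast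
  ultimately show "\<exists>F \<in> bounded_clop. K \<subseteq> F"
    by (metis interpolation empty_subsetI)
qed (use bounded_clop_iff bounded_down in blast)

text \<open>(BC2) shrinks only the right argument, so it is applied twice with a use of symmetry in
  between.\<close>

lemma near_bounded_iff:
  "(K, L) \<in> \<delta> \<longleftrightarrow> K \<subseteq> topspace X \<and> L \<subseteq> topspace X \<and>
    (\<exists>M \<in> \<B>. \<exists>N \<in> \<B>. M \<subseteq> K \<and> N \<subseteq> L \<and> (M, N) \<in> \<delta>)"
proof
  assume near: "(K, L) \<in> \<delta>"
  obtain N where N: "N \<in> \<B>" "N \<subseteq> L" "(K, N) \<in> \<delta>" using BC2[OF near] .
  obtain M where M: "M \<in> \<B>" "M \<subseteq> K" "(N, M) \<in> \<delta>" using BC2[OF near_sym[OF N(3)]] .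
  show "K \<subseteq> topspace X \<and> L \<subseteq> topspace X \<and>
    (\<exists>M \<in> \<B>. \<exists>N \<in> \<B>. M \<subseteq> K \<and> N \<subseteq> L \<and> (M, N) \<in> \<delta>)"
    using near_subset[OF near] M N near_sym by blast
qed (blast intro: near_mono)

text \<open>On bounded sets the two notions of nearness agree by \<open>bounded_far_iff\<close>; on
  arbitrary sets both are determined by their bounded subsets, one by construction and the other by
  \<open>near_bounded_iff\<close>.\<close>

lemma prox_of_alg_of_prox: "prox_of_alg X (alg_of_prox X (\<delta>, \<B>)) = (\<delta>, \<B>)"
proof -
  have "prox_of_alg X (clop, bounded_clop) = (\<delta>, \<B>)"
  proof (rule prod_eqI)
    have B: "{M. M \<subseteq> topspace X \<and> (\<exists>B \<in> bounded_clop. M \<subseteq> B)} = \<B>"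
      using bounded_iff bounded_subset by auto
    then show "snd (prox_of_alg X (clop, bounded_clop)) = snd (\<delta>, \<B>)"
      unfolding prox_of_alg_def Let_def prod.case snd_conv .
    have near: "(\<forall>F \<in> bounded_clop. M \<subseteq> F \<longrightarrow> F \<inter> N \<noteq> {}) \<longleftrightarrow> (M, N) \<in> \<delta>"
      if "M \<in> \<B>" "N \<in> \<B>" for M N
      using bounded_far_iff[OF that(1) bounded_subset[OF that(2)]] by blast
    have "(K \<subseteq> topspace X \<and> L \<subseteq> topspace X \<and> (\<exists>M \<in> \<B>. \<exists>N \<in> \<B>. M \<subseteq> K \<and> N \<subseteq> L \<and>
        (\<forall>F \<in> bounded_clop. M \<subseteq> F \<longrightarrow> F \<inter> N \<noteq> {}))) \<longleftrightarrow> (K, L) \<in> \<delta>" for K L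
      unfolding near_bounded_iff[of K L] by (intro conj_cong bex_cong refl near)
    then have "{(K, L). K \<subseteq> topspace X \<and> L \<subseteq> topspace X \<and> (\<exists>M \<in> \<B>. \<exists>N \<in> \<B>. M \<subseteq> K \<and> N \<subseteq> L \<and>
        (\<forall>F \<in> bounded_clop. M \<subseteq> F \<longrightarrow> F \<inter> N \<noteq> {}))} = \<delta>"
      by (simp only:) auto
    then show "fst (prox_of_alg X (clop, bounded_clop)) = fst (\<delta>, \<B>)"
      unfolding prox_of_alg_def Let_def prod.case fst_conv B .
  qed
  then show ?thesis by simp
qed

lemma clop_closedin:
  assumes "F \<in> clop"
  shows "closedin X F"
proof -
  have F: "F \<subseteq> topspace X" using assms clop_iff by blast
  have "X closure_of F \<subseteq> F"
  proof
    fix x assume "x \<in> X closure_of F"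
    then have x: "x \<in> topspace X" "({x}, F) \<in> \<delta>" using closure_iff[OF F] by auto
    show "x \<in> F"
    proof (rule ccontr)
      assume "x \<notin> F"
      then have "{x} \<subseteq> topspace X - F" using x by simp
      then have "(topspace X - F, F) \<in> \<delta>" using near_mono[OF x(2)] F by blast
      then show False using assms near_sym clop_iff by blast
    qed
  qed
  then show ?thesis using closure_of_subset_eq[of F X] F by blast
qed

lemma clop_compl: "F \<in> clop \<Longrightarrow> topspace X - F \<in> clop"
  unfolding clop_iff using near_sym by (auto simp: double_diff)

lemma clop_Un:
  assumes "F \<in> clop" "G \<in> clop"
  shows "F \<union> G \<in> clop"
proof -
  have sub: "F \<subseteq> topspace X" "G \<subseteq> topspace X" using assms clop_iff by auto
  let ?C = "topspace X - (F \<union> G)"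
  have "(?C, F) \<notin> \<delta>" "(?C, G) \<notin> \<delta>"
    using near_mono[of F ?C F "topspace X - F"] near_mono[of G ?C G "topspace X - G"]
      near_sym assms sub unfolding clop_iff by blast+
  then have "(?C, F \<union> G) \<notin> \<delta>" using near_Un[of ?C F G] sub by blast
  then show ?thesis using near_sym sub unfolding clop_iff by blast
qed

lemma admissible_pair: "admissible_pair X clop bounded_clop"
proof
  show "clop \<subseteq> Pow (topspace X)" using clop_iff by blast
  show empty: "{} \<in> clop" using clop_iff far_empty by blast
  show un: "a \<union> b \<in> clop" if "a \<in> clop" "b \<in> clop" for a b using that by (rule clop_Un)
  show "bounded_clop \<in> Idl clop"
  proof (rule IdlI)
    show "bounded_clop \<subseteq> clop" using bounded_clop_iff by blast
    show "{} \<in> bounded_clop"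
      using bounded_clop_iff empty Idl_empty[OF bounded_ideal] by blast
    show "b \<in> bounded_clop" if "a \<in> bounded_clop" "b \<in> clop" "b \<subseteq> a" for a b
      using that bounded_clop_iff bounded_down by blast
    show "a \<union> b \<in> bounded_clop" if "a \<in> bounded_clop" "b \<in> bounded_clop" for a b
      using that bounded_clop_iff un Idl_Un[OF bounded_ideal] by blast
  qed
  \<comment> \<open>The semiring form of closure under differences. The difference already belongs
    to \<open>clop\<close>, so the partition has one piece.\<close>
  show "\<exists>C \<subseteq> clop. finite C \<and> disjoint C \<and> a - b = \<Union> C" if "a \<in> clop" "b \<in> clop" for a b
  proof -
    have "a - b = topspace X - ((topspace X - a) \<union> b)" using that clop_iff by blast
    then have "a - b \<in> clop" using that clop_Un clop_compl by simp
    then show ?thesis by (intro exI[of _ "{a - b}"]) auto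
  qed
  show "a \<inter> b \<in> clop" if "a \<in> clop" "b \<in> clop" for a b
  proof -
    have "a \<inter> b = topspace X - ((topspace X - a) \<union> (topspace X - b))"
      using that clop_iff by blast
    then show ?thesis using that clop_Un clop_compl by simp
  qed
  show "topspace X \<in> clop" using clop_compl[OF empty] by simp
  show sub: "clop \<subseteq> clopens X"
    using clop_closedin clop_compl unfolding clopens_def
    by (auto simp: openin_closedin_eq clop_iff)
  show "open_base X bounded_clop"
    unfolding open_base_def openin_topology_base_unique
  proof (intro conjI allI impI)
    show "openin X V" if "V \<in> bounded_clop" for V
      using that sub bounded_clop_iff unfolding clopens_def by blast
    fix U x assume U: "openin X U \<and> x \<in> U"
    then have x: "x \<in> topspace X" "U \<subseteq> topspace X" using openin_subset by blast+
    \<comment> \<open>Points are bounded: (BC2) finds a bounded subset of \<open>{x}\<close> near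
      \<open>{x}\<close>, and this subset is nonempty because the empty set is far from
      everything.\<close>
    obtain B where "B \<in> \<B>" "B \<subseteq> {x}" "({x}, B) \<in> \<delta>"
      using BC2[OF near_refl[of "{x}"]] x by blast
    moreover have "B \<noteq> {}" using calculation far_empty near_sym x(1) by blast
    ultimately have bdd: "{x} \<in> \<B>" by (metis subset_singletonD)
    have "x \<notin> X closure_of (topspace X - U)"
      using U by (simp add: closure_of_closedin closedin_diff)
    then have "({x}, topspace X - U) \<notin> \<delta>" using closure_iff[of "topspace X - U"] x by blast
    then obtain F where F: "F \<in> bounded_clop" "{x} \<subseteq> F" "F \<inter> (topspace X - U) = {}"
      using interpolation[OF bdd] by blast
    moreover have "F \<subseteq> U" using F bounded_clop_iff clop_iff by blast
    ultimately show "\<exists>V. V \<in> bounded_clop \<and> x \<in> V \<and> V \<subseteq> U" by blast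
  qed
qed

sublocale clop: admissible_pair X clop bounded_clop
  by (rule admissible_pair)

text \<open>A union that belongs to the algebra is automatically the join. To see that it does, take
  bounded sets M inside the union and N outside it, cover both by one bounded clopen F, and split F
  at J into a and b. Since b misses the union, M lies in a; since a is inside the union, it misses
  N. So a separates M from N.\<close>

lemma simple_ideal_Union:
  assumes "simple_ideal bounded_clop J"
  shows "\<Union>J \<in> clop"
proof -
  have J: "J \<in> Idl bounded_clop" and
    split: "\<forall>F \<in> bounded_clop. \<exists>a \<in> J. \<exists>b \<in> bounded_clop. F = a \<union> b \<and> (\<forall>c \<in> J. b \<inter> c = {})"
    using iffD1[OF clop.simple_ideal_I_iff assms] by simp_all
  have sub: "\<Union>J \<subseteq> topspace X"
    using Idl_subset[OF J] bounded_clop_iff clop_iff by blast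
  have "(\<Union>J, topspace X - \<Union>J) \<notin> \<delta>"
  proof
    assume "(\<Union>J, topspace X - \<Union>J) \<in> \<delta>"
    then obtain M N where MN: "M \<in> \<B>" "N \<in> \<B>" "M \<subseteq> \<Union>J" "N \<subseteq> topspace X - \<Union>J" "(M, N) \<in> \<delta>"
      using near_bounded_iff by meson
    obtain F where F: "F \<in> bounded_clop" "M \<union> N \<subseteq> F"
      using bounded_iff[of "M \<union> N"] Idl_Un[OF bounded_ideal MN(1,2)] by blast
    obtain a b where ab: "a \<in> J" "F = a \<union> b" "\<forall>c \<in> J. b \<inter> c = {}"
      using bspec[OF split F(1)] by blast
    have "M \<subseteq> a" "a \<inter> N = {}" using MN F ab by blast+
    then show False
      using bounded_far_iff[OF MN(1)] MN(4,5) Idl_subset[OF J ab(1)] by blast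
  qed
  then show ?thesis using sub clop_iff[of "\<Union>J"] by simp
qed

lemma alg_of_prox_ZA: "alg_of_prox X (\<delta>, \<B>) \<in> ZA X"
proof -
  have "\<exists>b \<in> bounded_clop - {{}}. b \<subseteq> a" if a: "a \<in> clop - {{}}" for a
  proof -
    obtain x where x: "x \<in> a" using a by blast
    have "openin X a" using a clop.A_openin by blast
    then obtain F where "F \<in> bounded_clop" "x \<in> F" "F \<subseteq> a"
      using clop.base_obtain x by metis
    then show ?thesis by blast
  qed
  then have "LBA (topspace X) clop bounded_clop"
    unfolding LBA_def using clop.algebra_axioms clop.ideal by blast
  moreover have "has_join_in clop J" if J: "simple_ideal bounded_clop J" for J
    unfolding has_join_in_def using simple_ideal_Union[OF J] by blast
  ultimately have "(clop, bounded_clop) \<in> ZA X"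
    unfolding ZA_def ZLBA_def using clop.clopen clop.base by blast
  then show ?thesis by simp
qed

end

section \<open>The two constructions are mutually inverse and respect the orders\<close>

lemma alg_of_prox_of_alg:
  assumes "(A, I) \<in> ZA X"
  shows "alg_of_prox X (prox_of_alg X (A, I)) = (A, I)"
proof -
  interpret admissible_pair X A I using ZA_admissible_pair[OF assms] .
  have join: "simple_ideal I J \<Longrightarrow> has_join_in A J" for J
    using assms unfolding ZA_def ZLBA_def by blast
  have A: "F \<in> A" if F: "F \<subseteq> topspace X" "(F, topspace X - F) \<notin> prox" for F
  proof -
    let ?J = "{G \<in> I. G \<subseteq> F}"
    \<comment> \<open>A set inside G that contains \<open>F \<inter> G\<close> and misses the
      complement of F leaves no freedom: the separating set is the trace itself.\<close>
    have trace: "G \<inter> F \<in> I" if G: "G \<in> I" for G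
    proof -
      obtain H where H: "H \<in> I" "H \<subseteq> G" "F \<inter> G \<subseteq> H" "H \<inter> (topspace X - F) = {}"
        using farE[OF F(2,1) _ G] by blast
      then have "G \<inter> F = H" using A_subset[OF I_in_A] by blast
      then show ?thesis using H by simp
    qed
    have ideal_J: "?J \<in> Idl I" by (rule IdlI) (auto simp: I_empty I_Un)
    have split: "\<exists>a \<in> ?J. \<exists>b \<in> I. G = a \<union> b \<and> (\<forall>c \<in> ?J. b \<inter> c = {})" if G: "G \<in> I" for G
    proof (intro bexI conjI)
      show "G = (G \<inter> F) \<union> (G - (G \<inter> F))" by blast
      show "G - (G \<inter> F) \<in> I" using G trace I_Diff I_in_A by blast
    qed (use trace[OF G] in auto)
    have "simple_ideal I ?J"
      using ideal_J split unfolding simple_ideal_I_iff by (intro conjI ballI)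
    then obtain s where s: "s \<in> A" "\<forall>a \<in> ?J. a \<subseteq> s"
      and least: "\<forall>t \<in> A. (\<forall>a \<in> ?J. a \<subseteq> t) \<longrightarrow> s \<subseteq> t"
      using join unfolding has_join_in_def by meson
    have "F \<subseteq> s"
    proof
      fix x assume x: "x \<in> F"
      then obtain G where G: "G \<in> I" "x \<in> G" using I_covers F by blast
      then have "G \<inter> F \<subseteq> s" using s(2) trace[OF G(1)] by simp
      then show "x \<in> s" using x G by blast
    qed
    moreover have "s \<subseteq> F"
    proof (rule ccontr)
      assume "\<not> s \<subseteq> F"
      then obtain x where x: "x \<in> s" "x \<notin> F" by blast
      then obtain G where G: "G \<in> I" "x \<in> G" using I_covers A_subset s by blast
      \<comment> \<open>The join s might exceed the union of the ideal. Around a point x of s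
        outside F, the set \<open>?H\<close> is a member of A that is disjoint from F, so removing
        it from s leaves a smaller upper bound in A, against leastness.\<close>
      let ?H = "G - (G \<inter> F)"
      have "?H \<in> A" using G trace I_in_A Diff by blast
      then have "s - ?H \<in> A" using s by blast
      moreover have "\<forall>a \<in> ?J. a \<subseteq> s - ?H" using s by blast
      ultimately have "s \<subseteq> s - ?H" using least by blast
      then show False using x G by blast
    qed
    ultimately show ?thesis using s by simp
  qed
  have eqA: "{F. F \<subseteq> topspace X \<and> strongly_in (topspace X) prox F F} = A"
    unfolding strongly_in_def using A A_strongly A_subset by blast
  have "A \<inter> bounded_sets = I"
    using I_in_A I_down unfolding set_eq_iff Int_iff bounded_sets_iff by blast
  then have "alg_of_prox X (prox, bounded_sets) = (A, I)"
    unfolding alg_of_prox_def Let_def prod.case eqA by simp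
  then show ?thesis by simp
qed

lemma fst_alg_of_prox:
  "fst (alg_of_prox X q) = {F. F \<subseteq> topspace X \<and> (F, topspace X - F) \<notin> fst q}"
  unfolding alg_of_prox_def Let_def strongly_in_def by (simp add: case_prod_beta)

text \<open>Refinement of the ideals is inclusion of the bounded families. For the inclusion of
  proximities both halves of \<open>ZA_le\<close> are needed: a G in \<open>I2\<close> is enlarged
  to some U in \<open>I1\<close>, the separating F found in U lies in \<open>A1\<close> and so in
  \<open>A2\<close>, and \<open>G \<inter> F\<close> returns to \<open>I2\<close>. Conversely, an
  algebra consists of the sets far from their complement, so a smaller proximity has a larger
  algebra.\<close>

lemma ZA_le_iff_LP_le:
  assumes p: "p \<in> ZA X" and q: "q \<in> ZA X"
  shows "ZA_le p q \<longleftrightarrow> LP_le (prox_of_alg X p) (prox_of_alg X q)"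
proof -
  obtain A1 I1 A2 I2 where eq: "p = (A1, I1)" "q = (A2, I2)" by (metis surj_pair)
  interpret P: admissible_pair X A1 I1 using ZA_admissible_pair p eq by blast
  interpret Q: admissible_pair X A2 I2 using ZA_admissible_pair q eq by blast
  have bdd: "(\<forall>V \<in> I2. \<exists>U \<in> I1. V \<subseteq> U) \<longleftrightarrow> Q.bounded_sets \<subseteq> P.bounded_sets"
    unfolding subset_iff P.bounded_sets_iff Q.bounded_sets_iff by (meson order_refl order_trans)
  have "Q.prox \<subseteq> P.prox" if A: "A1 \<subseteq> A2" and I: "\<forall>V \<in> I2. \<exists>U \<in> I1. V \<subseteq> U"
  proof (rule subrelI, rule ccontr)
    fix K L assume near: "(K, L) \<in> Q.prox" and far: "(K, L) \<notin> P.prox"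
    then have sub: "K \<subseteq> topspace X" "L \<subseteq> topspace X" using Q.prox_subset by blast+
    have "\<exists>F \<in> I2. F \<subseteq> G \<and> K \<inter> G \<subseteq> F \<and> F \<inter> L = {}" if G: "G \<in> I2" for G
    proof -
      obtain U where U: "U \<in> I1" "G \<subseteq> U" using I G by blast
      obtain F where F: "F \<in> I1" "F \<subseteq> U" "K \<inter> U \<subseteq> F" "F \<inter> L = {}"
        using P.farE[OF far sub U(1)] .
      have "G \<inter> F \<in> I2" using Q.I_Int1[OF G] P.I_in_A[OF F(1)] A by blast
      then show ?thesis using F U by (intro bexI[of _ "G \<inter> F"]) auto
    qed
    then show False using near Q.far_iff[OF sub] by blast
  qed
  moreover have "A1 \<subseteq> A2" if le: "Q.prox \<subseteq> P.prox"
  proof -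
    have "A1 = fst (alg_of_prox X (prox_of_alg X (A1, I1)))"
      "A2 = fst (alg_of_prox X (prox_of_alg X (A2, I2)))"
      using alg_of_prox_of_alg[of A1 I1 X] alg_of_prox_of_alg[of A2 I2 X] p q eq by simp_all
    then show ?thesis using le unfolding fst_alg_of_prox by blast
  qed
  ultimately show ?thesis
    unfolding eq ZA_le_def LP_le_def using bdd by (auto simp: case_prod_beta)
qed

lemma is_poset_LP_le: "is_poset P LP_le"
  unfolding is_poset_def LP_le_def reflp_on_def transp_on_def antisymp_on_def by auto

section \<open>Ultrafilters in an algebra of sets\<close>

context algebra
begin

lemma ultrafilter_in_iff:
  "ultrafilter_in M u \<longleftrightarrow> proper_filter_in M u \<and> (\<forall>F \<in> M. F \<in> u \<or> \<Omega> - F \<in> u)"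
proof
  assume ultra: "ultrafilter_in M u"
  then have u: "proper_filter_in M u"
    and maxu: "\<And>v. proper_filter_in M v \<Longrightarrow> u \<subseteq> v \<Longrightarrow> v = u"
    unfolding ultrafilter_in_def by blast+
  have up: "\<And>a b. a \<in> u \<Longrightarrow> b \<in> M \<Longrightarrow> a \<subseteq> b \<Longrightarrow> b \<in> u"
    and int: "\<And>a b. a \<in> u \<Longrightarrow> b \<in> u \<Longrightarrow> a \<inter> b \<in> u"
    and ne: "u \<noteq> {}" and uM: "u \<subseteq> M"
    using u unfolding proper_filter_in_def by simp_all
  have "F \<in> u \<or> \<Omega> - F \<in> u" if F: "F \<in> M" for F
  proof (rule disjCI)
    assume notin: "\<Omega> - F \<notin> u"
    \<comment> \<open>The filter generated by u and F. It is proper because a member of u disjoint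
      from F would put the complement of F into u.\<close>
    define v where "v = {b \<in> M. \<exists>a \<in> u. a \<inter> F \<subseteq> b}"
    have "u \<subseteq> v" using uM unfolding v_def by blast
    moreover have "F \<in> v" using F ne unfolding v_def by blast
    moreover have "proper_filter_in M v"
      unfolding proper_filter_in_def
    proof (intro conjI ballI impI)
      show "v \<subseteq> M" unfolding v_def by blast
      show "v \<noteq> {}" using \<open>F \<in> v\<close> by blast
      show "{} \<notin> v"
      proof
        assume "{} \<in> v"
        then obtain a where a: "a \<in> u" "a \<inter> F = {}" unfolding v_def by blast
        then have "a \<subseteq> \<Omega> - F" using uM sets_into_space by blast
        then show False using up[OF a(1)] F notin by blast
      qed
      show "b \<in> v" if "a \<in> v" "b \<in> M" "a \<subseteq> b" for a b
        using that unfolding v_def by blast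
      show "a \<inter> b \<in> v" if ab: "a \<in> v" "b \<in> v" for a b
      proof -
        obtain c d where cd: "c \<in> u" "c \<inter> F \<subseteq> a" "d \<in> u" "d \<inter> F \<subseteq> b"
          using ab unfolding v_def by blast
        have "c \<inter> d \<inter> F \<subseteq> a \<inter> b" using cd by blast
        then show ?thesis using int[OF cd(1,3)] ab unfolding v_def by blast
      qed
    qed
    ultimately show "F \<in> u" using maxu by blast
  qed
  then show "proper_filter_in M u \<and> (\<forall>F \<in> M. F \<in> u \<or> \<Omega> - F \<in> u)" using u by blast
next
  assume u: "proper_filter_in M u \<and> (\<forall>F \<in> M. F \<in> u \<or> \<Omega> - F \<in> u)"
  have "v \<subseteq> u" if v: "proper_filter_in M v" "u \<subseteq> v" for v
  proof
    fix F assume F: "F \<in> v"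
    have vM: "v \<subseteq> M" "{} \<notin> v" and int: "\<And>a b. a \<in> v \<Longrightarrow> b \<in> v \<Longrightarrow> a \<inter> b \<in> v"
      using v(1) unfolding proper_filter_in_def by simp_all
    have "\<Omega> - F \<notin> v" using int[OF F, of "\<Omega> - F"] vM(2) by auto
    then show "F \<in> u" using u v(2) F vM(1) by blast
  qed
  then show "ultrafilter_in M u" using u unfolding ultrafilter_in_def by blast
qed

text \<open>Primeness: if b is not in u, its complement is, and cutting the union with this
  complement leaves a member of u below the union of the remaining sets.\<close>

lemma ultrafilter_Union:
  assumes u: "ultrafilter_in M u" and "finite T" "T \<subseteq> M" "\<Union>T \<in> u"
  shows "\<exists>b \<in> T. b \<in> u"
  using assms(2-)
proof (induction T rule: finite_induct)
  case empty
  then show ?case using u unfolding ultrafilter_in_def proper_filter_in_def by simp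
next
  case (insert b T)
  have up: "\<And>a b. a \<in> u \<Longrightarrow> b \<in> M \<Longrightarrow> a \<subseteq> b \<Longrightarrow> b \<in> u"
    and int: "\<And>a b. a \<in> u \<Longrightarrow> b \<in> u \<Longrightarrow> a \<inter> b \<in> u"
    using u unfolding ultrafilter_in_def proper_filter_in_def by simp_all
  have dec: "b \<in> u \<or> \<Omega> - b \<in> u"
    using u insert.prems(1) unfolding ultrafilter_in_iff by simp
  show ?case
  proof (cases "b \<in> u")
    case False
    then have "\<Union>(insert b T) \<inter> (\<Omega> - b) \<in> u" using dec int insert.prems by blast
    moreover have "\<Union>T \<in> M" using insert by (intro finite_Union) auto
    ultimately have "\<Union>T \<in> u" using up by blast
    then show ?thesis using insert by blast
  qed simp
qed

lemma ultrafilter_extends: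
  assumes "proper_filter_in M u"
  shows "\<exists>v. ultrafilter_in M v \<and> u \<subseteq> v"
proof -
  let ?P = "{v. proper_filter_in M v \<and> u \<subseteq> v}"
  have "\<exists>w \<in> ?P. \<forall>v \<in> ?P. w \<subseteq> v \<longrightarrow> v = w"
  proof (rule subset_Zorn_nonempty)
    show "?P \<noteq> {}" using assms by blast
    fix C assume ne: "C \<noteq> {}" and chain: "subset.chain ?P C"
    have CP: "\<And>c. c \<in> C \<Longrightarrow> proper_filter_in M c \<and> u \<subseteq> c"
      and lin: "\<And>c d. c \<in> C \<Longrightarrow> d \<in> C \<Longrightarrow> c \<subseteq> d \<or> d \<subseteq> c"
      using chain unfolding subset.chain_def by blast+
    have fil: "c \<subseteq> M" "c \<noteq> {}" "{} \<notin> c" "\<And>a b. a \<in> c \<Longrightarrow> b \<in> M \<Longrightarrow> a \<subseteq> b \<Longrightarrow> b \<in> c"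
      "\<And>a b. a \<in> c \<Longrightarrow> b \<in> c \<Longrightarrow> a \<inter> b \<in> c" if "c \<in> C" for c
      using CP[OF that] unfolding proper_filter_in_def by simp_all
    have "proper_filter_in M (\<Union>C)"
      unfolding proper_filter_in_def
    proof (intro conjI ballI impI)
      show "\<Union>C \<subseteq> M" "\<Union>C \<noteq> {}" "{} \<notin> \<Union>C" using fil(1-3) ne by blast+
      show "b \<in> \<Union>C" if ab: "a \<in> \<Union>C" "b \<in> M" "a \<subseteq> b" for a b
        using ab fil(4) by blast
      show "a \<inter> b \<in> \<Union>C" if ab: "a \<in> \<Union>C" "b \<in> \<Union>C" for a b
      proof -
        obtain c d where "c \<in> C" "a \<in> c" "d \<in> C" "b \<in> d" using ab by blast
        then obtain e where "e \<in> C" "a \<in> e" "b \<in> e" using lin by blast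
        then show ?thesis using fil(5) by blast
      qed
    qed
    then show "\<Union>C \<in> ?P" using CP ne by blast
  qed
  then obtain w where w: "proper_filter_in M w" "u \<subseteq> w" "\<forall>v \<in> ?P. w \<subseteq> v \<longrightarrow> v = w" by blast
  then have "ultrafilter_in M w" unfolding ultrafilter_in_def by blast
  then show ?thesis using w(2) by blast
qed

end


section \<open>The space of bounded ultrafilters\<close>

context admissible_pair
begin

abbreviation basic :: "'a set \<Rightarrow> 'a set set set" where
  "basic a \<equiv> {u \<in> bounded_ultrafilters A I. a \<in> u}"

lemma bounded_ultrafilterD:
  assumes "u \<in> bounded_ultrafilters A I"
  shows "u \<subseteq> A" "{} \<notin> u" "\<And>a b. a \<in> u \<Longrightarrow> b \<in> A \<Longrightarrow> a \<subseteq> b \<Longrightarrow> b \<in> u"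
    "\<And>a b. a \<in> u \<Longrightarrow> b \<in> u \<Longrightarrow> a \<inter> b \<in> u" "\<And>F. F \<in> A \<Longrightarrow> F \<in> u \<or> topspace X - F \<in> u"
    "ultrafilter_in A u" "\<exists>a \<in> I. a \<in> u"
proof -
  have "ultrafilter_in A u" "u \<inter> I \<noteq> {}"
    using assms unfolding bounded_ultrafilters_def by auto
  then show "u \<subseteq> A" "{} \<notin> u" "\<And>a b. a \<in> u \<Longrightarrow> b \<in> A \<Longrightarrow> a \<subseteq> b \<Longrightarrow> b \<in> u"
    "\<And>a b. a \<in> u \<Longrightarrow> b \<in> u \<Longrightarrow> a \<inter> b \<in> u" "\<And>F. F \<in> A \<Longrightarrow> F \<in> u \<or> topspace X - F \<in> u"
    "ultrafilter_in A u" "\<exists>a \<in> I. a \<in> u"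
    unfolding ultrafilter_in_iff proper_filter_in_def by auto
qed

lemma bounded_ultrafilterI:
  assumes "u \<subseteq> A" "{} \<notin> u" "\<And>a b. a \<in> u \<Longrightarrow> b \<in> A \<Longrightarrow> a \<subseteq> b \<Longrightarrow> b \<in> u"
    "\<And>a b. a \<in> u \<Longrightarrow> b \<in> u \<Longrightarrow> a \<inter> b \<in> u" "\<And>F. F \<in> A \<Longrightarrow> F \<in> u \<or> topspace X - F \<in> u"
    "a \<in> I" "a \<in> u"
  shows "u \<in> bounded_ultrafilters A I"
proof -
  have "proper_filter_in A u" unfolding proper_filter_in_def using assms by auto
  then have "ultrafilter_in A u" unfolding ultrafilter_in_iff using assms(5) by blast
  then show ?thesis unfolding bounded_ultrafilters_def using assms(6,7) by blast
qed

lemma basic_Int: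
  assumes "a \<in> A" "b \<in> A"
  shows "basic a \<inter> basic b = basic (a \<inter> b)"
proof (intro set_eqI iffI)
  fix u assume "u \<in> basic (a \<inter> b)"
  then have u: "u \<in> bounded_ultrafilters A I" "a \<inter> b \<in> u" by simp_all
  have "a \<in> u" "b \<in> u"
    using bounded_ultrafilterD(3)[OF u] assms by auto
  then show "u \<in> basic a \<inter> basic b" using u by simp
qed (use bounded_ultrafilterD(4) in simp)

lemma openin_Theta:
  "openin (Theta A I) = arbitrary union_of (\<lambda>U. \<exists>a \<in> I. U = basic a)"
  unfolding Theta_def
proof (rule topology_inverse', rule istopology_base)
  fix S T assume "\<exists>a \<in> I. S = basic a" "\<exists>a \<in> I. T = basic a"
  then obtain a b where "a \<in> I" "S = basic a" "b \<in> I" "T = basic b" by blast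
  moreover have "basic a \<inter> basic b = basic (a \<inter> b)"
    using calculation by (intro basic_Int I_in_A)
  ultimately show "\<exists>a \<in> I. S \<inter> T = basic a"
    using I_Int by (intro bexI[of _ "a \<inter> b"]) simp_all
qed

lemma openin_basic: "a \<in> I \<Longrightarrow> openin (Theta A I) (basic a)"
  unfolding openin_Theta by (rule arbitrary_union_of_inc) blast

lemma Theta_base_obtain:
  assumes "openin (Theta A I) U" "u \<in> U"
  obtains a where "a \<in> I" "a \<in> u" "u \<in> bounded_ultrafilters A I" "basic a \<subseteq> U"
proof -
  have "\<exists>V. (\<exists>a \<in> I. V = basic a) \<and> u \<in> V \<and> V \<subseteq> U"
    using openin_Theta assms unfolding openin_topology_base_unique by meson
  then show thesis using that by blast
qed

lemma topspace_Theta: "topspace (Theta A I) = bounded_ultrafilters A I"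
proof
  show "topspace (Theta A I) \<subseteq> bounded_ultrafilters A I"
    using Theta_base_obtain[OF openin_topspace] by blast
  show "bounded_ultrafilters A I \<subseteq> topspace (Theta A I)"
    using bounded_ultrafilterD(7) openin_subset[OF openin_basic] by blast
qed

lemma Hausdorff_Theta: "Hausdorff_space (Theta A I)"
  unfolding Hausdorff_space_def topspace_Theta
proof (intro allI impI)
  fix u v assume uv: "u \<in> bounded_ultrafilters A I \<and> v \<in> bounded_ultrafilters A I \<and> u \<noteq> v"
  have "u \<subseteq> v \<Longrightarrow> v = u"
    using uv unfolding bounded_ultrafilters_def ultrafilter_in_def by blast
  then obtain F where F: "F \<in> u" "F \<notin> v" using uv by blast
  have FA: "F \<in> A" using F uv bounded_ultrafilterD(1) by blast
  then have Fv: "topspace X - F \<in> v" using F uv bounded_ultrafilterD(5) by blast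
  \<comment> \<open>Only members of I index basic open sets, so F and its complement are cut down by
    bounded members of the two ultrafilters.\<close>
  obtain G H where GH: "G \<in> I" "G \<in> u" "H \<in> I" "H \<in> v" using uv bounded_ultrafilterD(7) by blast
  let ?U = "F \<inter> G" and ?V = "(topspace X - F) \<inter> H"
  have I: "?U \<in> I" "?V \<in> I" using I_Int2 FA GH compl_sets by blast+
  have "disjnt (basic ?U) (basic ?V)"
  proof -
    have "basic ?U \<inter> basic ?V = basic (?U \<inter> ?V)" using I by (intro basic_Int I_in_A)
    also have "?U \<inter> ?V = {}" by blast
    also have "basic {} = {}" using bounded_ultrafilterD(2) by blast
    finally show ?thesis unfolding disjnt_def .
  qed
  moreover have "u \<in> basic ?U" "v \<in> basic ?V"
    using uv F(1) Fv GH bounded_ultrafilterD(4) by simp_all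
  ultimately show "\<exists>U V. openin (Theta A I) U \<and> openin (Theta A I) V \<and> u \<in> U \<and> v \<in> V \<and> disjnt U V"
    using openin_basic I by blast
qed

text \<open>Compactness is reduced to covering the set a itself. The family \<open>\<T>\<close>
  collects the members of I whose basic set refines the open cover. If finitely many of them cover
  a, primeness of ultrafilters shows that their basic sets cover \<open>basic a\<close>.\<close>

lemma compactin_basic:
  assumes a: "a \<in> I"
  shows "compactin (Theta A I) (basic a)"
  unfolding compactin_def topspace_Theta
proof (intro conjI allI impI)
  fix \<U> assume \<U>: "Ball \<U> (openin (Theta A I)) \<and> basic a \<subseteq> \<Union>\<U>"
  define \<T> where "\<T> = {b \<in> I. \<exists>U \<in> \<U>. basic b \<subseteq> U}"
  have "\<exists>T. finite T \<and> T \<subseteq> \<T> \<and> a \<subseteq> \<Union>T"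
  proof (rule ccontr)
    assume none: "\<not> ?thesis"
    \<comment> \<open>The sets that contain a up to finitely many members of \<open>\<T>\<close>. An
      ultrafilter w above this filter contains a, so w is bounded and lies in a member of the cover.
      Hence w contains some b in \<open>\<T>\<close>, whose complement is in v by
      construction.\<close>
    define v where "v = {c \<in> A. \<exists>T. finite T \<and> T \<subseteq> \<T> \<and> a \<subseteq> c \<union> \<Union>T}"
    have av: "a \<in> v" unfolding v_def using a I_in_A by blast
    have "proper_filter_in A v"
      unfolding proper_filter_in_def
    proof (intro conjI ballI impI)
      show "v \<subseteq> A" unfolding v_def by blast
      show "v \<noteq> {}" using av by blast
      show "{} \<notin> v" using none unfolding v_def by simp
      show "d \<in> v" if "c \<in> v" "d \<in> A" "c \<subseteq> d" for c d
        using that unfolding v_def by (simp, meson Un_mono order_refl subset_trans)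
      show "c \<inter> d \<in> v" if cd: "c \<in> v" "d \<in> v" for c d
      proof -
        obtain S T where S: "finite S" "S \<subseteq> \<T>" "a \<subseteq> c \<union> \<Union>S"
          and T: "finite T" "T \<subseteq> \<T>" "a \<subseteq> d \<union> \<Union>T"
          using cd unfolding v_def by blast
        have "a \<subseteq> (c \<inter> d) \<union> \<Union>(S \<union> T)" using S(3) T(3) by blast
        moreover have "finite (S \<union> T)" "S \<union> T \<subseteq> \<T>" using S T by blast+
        ultimately have "\<exists>T. finite T \<and> T \<subseteq> \<T> \<and> a \<subseteq> (c \<inter> d) \<union> \<Union>T" by blast
        moreover have "c \<inter> d \<in> A" using cd unfolding v_def by blast
        ultimately show ?thesis unfolding v_def by simp
      qed
    qed
    then obtain w where w: "ultrafilter_in A w" "v \<subseteq> w" using ultrafilter_extends by blast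
    then have wb: "w \<in> bounded_ultrafilters A I"
      using av a unfolding bounded_ultrafilters_def by blast
    then obtain U where U: "U \<in> \<U>" "w \<in> U" using w av \<U> by blast
    have "openin (Theta A I) U" using U(1) \<U> by simp
    then obtain b where b: "b \<in> I" "b \<in> w" "basic b \<subseteq> U"
      using Theta_base_obtain[OF _ U(2)] by metis
    then have "b \<in> \<T>" unfolding \<T>_def using U by blast
    moreover have "topspace X - b \<in> A" using I_in_A[OF b(1)] by blast
    moreover have "a \<subseteq> (topspace X - b) \<union> \<Union>{b}" using A_subset[OF I_in_A[OF a]] by blast
    ultimately have "topspace X - b \<in> v"
      unfolding v_def by (intro CollectI conjI exI[of _ "{b}"]) auto
    then have "b \<inter> (topspace X - b) \<in> w" using bounded_ultrafilterD(4)[OF wb b(2)] w(2) by blast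
    then show False using bounded_ultrafilterD(2)[OF wb] by simp
  qed
  then obtain T where T: "finite T" "T \<subseteq> \<T>" "a \<subseteq> \<Union>T" by blast
  have "\<forall>b \<in> T. \<exists>U \<in> \<U>. basic b \<subseteq> U" using T(2) unfolding \<T>_def by blast
  then obtain g where g: "\<forall>b \<in> T. g b \<in> \<U> \<and> basic b \<subseteq> g b" by metis
  have TI: "T \<subseteq> I" using T(2) unfolding \<T>_def by blast
  have "basic a \<subseteq> \<Union>(g ` T)"
  proof
    fix u assume "u \<in> basic a"
    then have u: "u \<in> bounded_ultrafilters A I" "a \<in> u" by simp_all
    have "\<Union>T \<in> u"
      using bounded_ultrafilterD(3)[OF u] I_in_A[OF I_UN] T TI by blast
    then obtain b where "b \<in> T" "b \<in> u"
      using ultrafilter_Union[OF bounded_ultrafilterD(6)[OF u(1)] T(1)] TI I_in_A by blast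
    then show "u \<in> \<Union>(g ` T)" using g u(1) by blast
  qed
  then show "\<exists>\<F>. finite \<F> \<and> \<F> \<subseteq> \<U> \<and> basic a \<subseteq> \<Union>\<F>"
    using g T(1) by (intro exI[of _ "g ` T"]) auto
qed blast

lemma locally_compact_Theta: "locally_compact_space (Theta A I)"
  unfolding locally_compact_space_def topspace_Theta
proof
  fix u assume u: "u \<in> bounded_ultrafilters A I"
  then obtain a where "a \<in> I" "a \<in> u" using bounded_ultrafilterD(7) by blast
  then show "\<exists>U K. openin (Theta A I) U \<and> compactin (Theta A I) K \<and> u \<in> U \<and> U \<subseteq> K"
    using openin_basic compactin_basic u by blast
qed

section \<open>The embedding of X as a dense subspace of principal ultrafilters\<close>

abbreviation emb :: "'a \<Rightarrow> 'a set set" where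
  "emb \<equiv> Theta_embedding A"

lemma mem_emb_iff: "F \<in> emb x \<longleftrightarrow> F \<in> A \<and> x \<in> F"
  unfolding Theta_embedding_def by simp

lemma emb_bounded:
  assumes "x \<in> topspace X"
  shows "emb x \<in> bounded_ultrafilters A I"
proof -
  obtain a where "a \<in> I" "x \<in> a" using I_covers assms by blast
  then show ?thesis
    using assms by (intro bounded_ultrafilterI[of _ a]) (auto simp: mem_emb_iff I_in_A)
qed

lemma emb_image_Int_basic:
  assumes "a \<in> I" "M \<subseteq> topspace X"
  shows "emb ` M \<inter> basic a = emb ` (M \<inter> a)"
  using emb_bounded assms by (auto simp: mem_emb_iff I_in_A)

lemma closure_emb:
  assumes M: "M \<subseteq> topspace X"
  shows "Theta A I closure_of (emb ` M) =
    {u \<in> bounded_ultrafilters A I. \<forall>a \<in> u. a \<inter> M \<noteq> {}}"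
proof (intro set_eqI iffI)
  fix u assume u: "u \<in> Theta A I closure_of (emb ` M)"
  then have ub: "u \<in> bounded_ultrafilters A I" by (simp add: in_closure_of topspace_Theta)
  have "a \<inter> M \<noteq> {}" if a: "a \<in> u" for a
  proof -
    \<comment> \<open>A general a in u does not index a basic neighbourhood; intersecting it with a
      bounded b in u gives one that does.\<close>
    obtain b where b: "b \<in> I" "b \<in> u" using bounded_ultrafilterD(7)[OF ub] by blast
    have "a \<inter> b \<in> I" using I_Int2 b bounded_ultrafilterD(1)[OF ub] a by blast
    moreover have "u \<in> basic (a \<inter> b)" using ub bounded_ultrafilterD(4)[OF ub a b(2)] by simp
    moreover have "\<forall>T. u \<in> T \<and> openin (Theta A I) T \<longrightarrow> (\<exists>y. y \<in> emb ` M \<and> y \<in> T)"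
      using u unfolding in_closure_of by (rule conjunct2)
    ultimately have "emb ` M \<inter> basic (a \<inter> b) \<noteq> {}"
      using openin_basic[of "a \<inter> b"] by (metis IntI empty_iff)
    then show ?thesis using emb_image_Int_basic[OF \<open>a \<inter> b \<in> I\<close> M] by blast
  qed
  then show "u \<in> {u \<in> bounded_ultrafilters A I. \<forall>a \<in> u. a \<inter> M \<noteq> {}}" using ub by simp
next
  fix u assume "u \<in> {u \<in> bounded_ultrafilters A I. \<forall>a \<in> u. a \<inter> M \<noteq> {}}"
  then have u: "u \<in> bounded_ultrafilters A I" "\<And>a. a \<in> u \<Longrightarrow> a \<inter> M \<noteq> {}" by simp_all
  have "\<exists>y. y \<in> emb ` M \<and> y \<in> T" if T: "u \<in> T \<and> openin (Theta A I) T" for T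
  proof -
    obtain a where a: "a \<in> I" "a \<in> u" "basic a \<subseteq> T" using Theta_base_obtain[of T u] T by metis
    then have "emb ` M \<inter> basic a \<noteq> {}"
      using u(2)[OF a(2)] emb_image_Int_basic[OF a(1) M] by blast
    then show ?thesis using a(3) by blast
  qed
  then show "u \<in> Theta A I closure_of (emb ` M)"
    using u(1) unfolding in_closure_of topspace_Theta by blast
qed

lemma Theta_extension:
  assumes "Hausdorff_space X"
  shows "(Theta A I, emb) \<in> extensions X"
proof -
  have inj: "inj_on emb (topspace X)"
  proof (rule inj_onI, rule ccontr)
    fix x y assume xy: "x \<in> topspace X" "y \<in> topspace X" "emb x = emb y" "x \<noteq> y"
    then obtain U where "openin X U" "x \<in> U" "y \<notin> U"
      using assms unfolding Hausdorff_space_def disjnt_iff by metis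
    then obtain F where "F \<in> I" "x \<in> F" "y \<notin> F" using base_obtain by blast
    then show False using xy(3) mem_emb_iff I_in_A by metis
  qed
  let ?S = "subtopology (Theta A I) (emb ` topspace X)"
  have top: "topspace ?S = emb ` topspace X"
    using emb_bounded unfolding topspace_subtopology topspace_Theta by blast
  have "homeomorphic_map X ?S emb"
  proof (rule bijective_open_imp_homeomorphic_map)
    show "continuous_map X ?S emb"
      unfolding continuous_map_in_subtopology
    proof (intro conjI)
      show "continuous_map X (Theta A I) emb"
        unfolding continuous_map_def
      proof (intro conjI allI impI)
        show "emb \<in> topspace X \<rightarrow> topspace (Theta A I)" using emb_bounded topspace_Theta by blast
        fix U assume U: "openin (Theta A I) U"
        show "openin X {x \<in> topspace X. emb x \<in> U}"
        proof (subst openin_subopen, intro ballI)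
          fix x assume "x \<in> {x \<in> topspace X. emb x \<in> U}"
          then have x: "x \<in> topspace X" "emb x \<in> U" by simp_all
          obtain a where a: "a \<in> I" "a \<in> emb x" "basic a \<subseteq> U"
            using Theta_base_obtain[OF U x(2)] by metis
          have "a \<subseteq> {x \<in> topspace X. emb x \<in> U}"
          proof
            fix y assume y: "y \<in> a"
            then have "y \<in> topspace X" using A_subset[OF I_in_A[OF a(1)]] by blast
            moreover from this have "emb y \<in> basic a"
              using emb_bounded mem_emb_iff I_in_A[OF a(1)] y by simp
            ultimately show "y \<in> {x \<in> topspace X. emb x \<in> U}" using a(3) by blast
          qed
          then show "\<exists>T. openin X T \<and> x \<in> T \<and> T \<subseteq> {x \<in> topspace X. emb x \<in> U}"
            using A_openin[OF I_in_A[OF a(1)]] a(2) by (intro exI[of _ a]) (simp add: mem_emb_iff)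
        qed
      qed
    qed blast
    \<comment> \<open>It is enough to look at base sets: the image of a member a of I is the trace
      of \<open>basic a\<close> on the image of X.\<close>
    show "open_map X ?S emb"
      unfolding open_map_def
    proof (intro allI impI)
      fix U assume U: "openin X U"
      show "openin ?S (emb ` U)"
      proof (subst openin_subopen, intro ballI)
        fix u assume "u \<in> emb ` U"
        then obtain x where x: "x \<in> U" "u = emb x" by blast
        then obtain a where a: "a \<in> I" "x \<in> a" "a \<subseteq> U" using base_obtain U by blast
        have "emb ` topspace X \<inter> basic a = emb ` a"
          using emb_image_Int_basic[OF a(1) order_refl] A_subset[OF I_in_A[OF a(1)]]
          by (simp add: Int_absorb1)
        then have "openin ?S (emb ` a)"
          using openin_subtopology_Int2[OF openin_basic[OF a(1)], of "emb ` topspace X"] by simp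
        then show "\<exists>T. openin ?S T \<and> u \<in> T \<and> T \<subseteq> emb ` U" using x a by blast
      qed
    qed
  qed (use inj top in simp_all)
  moreover have "Theta A I closure_of (emb ` topspace X) = topspace (Theta A I)"
    unfolding closure_emb[OF order_refl] topspace_Theta
  proof -
    have "a \<inter> topspace X \<noteq> {}" if "u \<in> bounded_ultrafilters A I" "a \<in> u" for u a
      using bounded_ultrafilterD(1,2)[OF that(1)] that(2) A_subset by (metis Int_absorb2 subsetD)
    then show "{u \<in> bounded_ultrafilters A I. \<forall>a \<in> u. a \<inter> topspace X \<noteq> {}} = bounded_ultrafilters A I"
      by blast
  qed
  ultimately show ?thesis unfolding extensions_def embedding_map_def by simp
qed

section \<open>The local proximity induced by the ultrafilter space\<close>

lemma compact_closure_cover: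
  assumes M: "M \<subseteq> topspace X" and J: "J \<subseteq> I"
    and K: "compactin (Theta A I) (Theta A I closure_of (emb ` M))"
    and cover: "Theta A I closure_of (emb ` M) \<subseteq> \<Union>(basic ` J)"
  obtains S where "finite S" "S \<subseteq> J" "M \<subseteq> \<Union>S"
proof -
  have "\<exists>\<F>. finite \<F> \<and> \<F> \<subseteq> basic ` J \<and> Theta A I closure_of (emb ` M) \<subseteq> \<Union>\<F>"
    using K _ cover by (rule compactinD) (use openin_basic J in blast)
  then obtain T where T: "finite T" "T \<subseteq> basic ` J" "Theta A I closure_of (emb ` M) \<subseteq> \<Union>T"
    by (elim exE conjE)
  obtain S where S: "S \<subseteq> J" "finite S" "T = basic ` S"
    using finite_subset_image[OF T(1,2)] by blast
  \<comment> \<open>A point x of M enters the closure as \<open>emb x\<close>, which contains a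
    member of A exactly when x lies in it. A cover by basic sets thus restricts to a cover of M by
    their indices.\<close>
  have "M \<subseteq> \<Union>S"
  proof
    fix x assume x: "x \<in> M"
    have "emb ` M \<subseteq> topspace (Theta A I)" using emb_bounded M topspace_Theta by blast
    then have "emb x \<in> Theta A I closure_of (emb ` M)"
      using closure_of_subset[of "emb ` M"] x by blast
    then show "x \<in> \<Union>S" using T(3) S(3) mem_emb_iff by blast
  qed
  then show thesis using that S by blast
qed

text \<open>If M lies in F, its closure is closed inside the compact set \<open>basic F\<close>.
  Conversely, the basic sets of all members of I cover the closure, and a finite union of members of
  I is again in I.\<close>

lemma compact_closure_emb_iff:
  assumes M: "M \<subseteq> topspace X"
  shows "compactin (Theta A I) (Theta A I closure_of (emb ` M)) \<longleftrightarrow> (\<exists>F \<in> I. M \<subseteq> F)"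
proof
  assume "\<exists>F \<in> I. M \<subseteq> F"
  then obtain F where F: "F \<in> I" "M \<subseteq> F" by blast
  have "emb ` M \<subseteq> basic F"
    using M F emb_bounded I_in_A by (auto simp: mem_emb_iff)
  then have "Theta A I closure_of (emb ` M) \<subseteq> basic F"
    by (intro closure_of_minimal compactin_imp_closedin[OF Hausdorff_Theta] compactin_basic F(1))
  then show "compactin (Theta A I) (Theta A I closure_of (emb ` M))"
    by (rule closed_compactin[OF compactin_basic[OF F(1)]]) simp
next
  let ?C = "Theta A I closure_of (emb ` M)"
  assume K: "compactin (Theta A I) ?C"
  have "?C \<subseteq> \<Union>(basic ` I)"
    using bounded_ultrafilterD(7) unfolding closure_emb[OF M] by blast
  then obtain S where "finite S" "S \<subseteq> I" "M \<subseteq> \<Union>S"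
    using compact_closure_cover[OF M order_refl K] by metis
  then show "\<exists>F \<in> I. M \<subseteq> F" using I_UN by blast
qed

text \<open>A common closure point u contains some G in I. A set F separating M from N inside G
  misses N and so is not in u; then \<open>G - F\<close> would be in u although it misses M.
  Conversely, nearness passes to a bounded \<open>M'\<close>, whose closure is compact. If that
  closure missed the closure of \<open>N'\<close>, it would be covered by basic sets of members of I
  disjoint from \<open>N'\<close>, and the union of finitely many of these would separate
  \<open>M'\<close> from \<open>N'\<close>.\<close>

lemma closures_meet_iff:
  assumes M: "M \<subseteq> topspace X" and N: "N \<subseteq> topspace X"
  shows "Theta A I closure_of (emb ` M) \<inter> Theta A I closure_of (emb ` N) \<noteq> {} \<longleftrightarrow> (M, N) \<in> prox"
proof
  assume "Theta A I closure_of (emb ` M) \<inter> Theta A I closure_of (emb ` N) \<noteq> {}"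
  then obtain u where "u \<in> Theta A I closure_of (emb ` M)" "u \<in> Theta A I closure_of (emb ` N)"
    by (meson disjoint_iff)
  then have u: "u \<in> bounded_ultrafilters A I"
    and uM: "\<And>a. a \<in> u \<Longrightarrow> a \<inter> M \<noteq> {}" and uN: "\<And>a. a \<in> u \<Longrightarrow> a \<inter> N \<noteq> {}"
    unfolding closure_emb[OF M] closure_emb[OF N] by simp_all
  show "(M, N) \<in> prox"
  proof (rule ccontr)
    assume far: "(M, N) \<notin> prox"
    obtain G where G: "G \<in> I" "G \<in> u" using bounded_ultrafilterD(7)[OF u] by blast
    obtain F where F: "F \<in> I" "F \<subseteq> G" "M \<inter> G \<subseteq> F" "F \<inter> N = {}" using farE[OF far M N G(1)] .
    have "F \<notin> u" using uN F(4) by blast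
    then have "topspace X - F \<in> u" using bounded_ultrafilterD(5)[OF u] I_in_A[OF F(1)] by blast
    then have "G \<inter> (topspace X - F) \<in> u" using bounded_ultrafilterD(4)[OF u G(2)] by blast
    then show False using uM F(3) by blast
  qed
next
  assume "(M, N) \<in> prox"
  then obtain M' N' B where MN: "M' \<subseteq> M" "N' \<subseteq> N" "B \<in> I" "M' \<subseteq> B"
    and near: "\<And>F. F \<in> I \<Longrightarrow> M' \<subseteq> F \<Longrightarrow> F \<inter> N' \<noteq> {}"
    unfolding prox_of_alg_def Let_def by auto
  let ?C = "\<lambda>M. Theta A I closure_of (emb ` M)"
  have sub: "M' \<subseteq> topspace X" "N' \<subseteq> topspace X" using MN M N by blast+
  have "?C M' \<inter> ?C N' \<noteq> {}"
  proof
    assume disj: "?C M' \<inter> ?C N' = {}"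
    let ?S = "{a \<in> I. a \<inter> N' = {}}"
    have cover: "?C M' \<subseteq> \<Union>(basic ` ?S)"
    proof
      fix u assume uC: "u \<in> ?C M'"
      then have u: "u \<in> bounded_ultrafilters A I" using closure_emb[OF sub(1)] by blast
      have "u \<notin> ?C N'" using uC disj by blast
      then obtain a where a: "a \<in> u" "a \<inter> N' = {}" using u closure_emb[OF sub(2)] by blast
      obtain G where G: "G \<in> I" "G \<in> u" using bounded_ultrafilterD(7)[OF u] by blast
      have "a \<inter> G \<in> ?S" using I_Int2[OF _ G(1)] bounded_ultrafilterD(1)[OF u] a by blast
      moreover have "u \<in> basic (a \<inter> G)" using u bounded_ultrafilterD(4)[OF u a(1) G(2)] by simp
      ultimately show "u \<in> \<Union>(basic ` ?S)" by blast
    qed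
    have "compactin (Theta A I) (?C M')"
      using compact_closure_emb_iff[OF sub(1)] MN(3,4) by blast
    then obtain S where S: "finite S" "S \<subseteq> ?S" "M' \<subseteq> \<Union>S"
      using compact_closure_cover[OF sub(1) _ _ cover] by (metis (no_types, lifting) mem_Collect_eq subsetI)
    have "\<Union>S \<in> I" using S by (intro I_UN) auto
    moreover have "\<Union>S \<inter> N' = {}" using S(2) by blast
    ultimately show False using near[of "\<Union>S"] S(3) by blast
  qed
  moreover have "?C M' \<subseteq> ?C M" "?C N' \<subseteq> ?C N" using MN by (auto intro!: closure_of_mono image_mono)
  ultimately show "?C M \<inter> ?C N \<noteq> {}" by blast
qed

lemma ext_prox_Theta: "ext_prox X (Theta A I, emb) = prox_of_alg X (A, I)"
proof -
  have "(M \<subseteq> topspace X \<and> N \<subseteq> topspace X \<and>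
      Theta A I closure_of (emb ` M) \<inter> Theta A I closure_of (emb ` N) \<noteq> {}) \<longleftrightarrow> (M, N) \<in> prox" for M N
    using closures_meet_iff[of M N] prox_subset[of M N] by blast
  then have "{(M, N). M \<subseteq> topspace X \<and> N \<subseteq> topspace X \<and>
      Theta A I closure_of (emb ` M) \<inter> Theta A I closure_of (emb ` N) \<noteq> {}} = prox"
    by (simp only:) auto
  moreover have "{M. M \<subseteq> topspace X \<and> compactin (Theta A I) (Theta A I closure_of (emb ` M))} = bounded_sets"
  proof (rule set_eqI)
    fix M
    have "M \<in> bounded_sets \<Longrightarrow> M \<subseteq> topspace X"
      unfolding bounded_sets_iff using A_subset[OF I_in_A] by blast
    then show "M \<in> {M. M \<subseteq> topspace X \<and> compactin (Theta A I) (Theta A I closure_of (emb ` M))} \<longleftrightarrow>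
        M \<in> bounded_sets"
      using compact_closure_emb_iff[of M] bounded_sets_iff[of M] by blast
  qed
  ultimately have "ext_prox X (Theta A I, emb) = (prox, bounded_sets)"
    unfolding ext_prox_def by (simp only: prod.case)
  then show ?thesis by simp
qed

text \<open>
  The homeomorphism sends \<open>y\<close> to the ultrafilter of all \<open>F \<in> A\<close> with \<open>y\<close> in the closure of \<open>f ` F\<close>;
  those closures are clopen because \<open>F\<close> is far from its complement.
\<close>

lemma extension_homeomorphic_Theta:
  assumes ext: "(Y, f) \<in> extensions X" and lc: "locally_compact_space Y"
    and Haus: "Hausdorff_space Y" and eq: "ext_prox X (Y, f) = prox_of_alg X (A, I)"
  shows "\<exists>h. homeomorphic_map Y (Theta A I) h \<and> (\<forall>x \<in> topspace X. h (f x) = emb x)"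
proof -
  define E where "E M = Y closure_of (f ` M)" for M
  have dense: "E (topspace X) = topspace Y"
    using ext unfolding extensions_def E_def by simp
  have fY: "f x \<in> topspace Y" if "x \<in> topspace X" for x
    using extension_image_subset[OF ext] that by blast
  have E_mem: "f x \<in> E M" if "x \<in> M" "M \<subseteq> topspace X" for x M
  proof -
    have "f ` M \<subseteq> topspace Y" using fY that(2) by blast
    then show ?thesis unfolding E_def using closure_of_subset that(1) by blast
  qed
  have E_mono: "E M \<subseteq> E N" if "M \<subseteq> N" for M N
    unfolding E_def using that by (intro closure_of_mono image_mono)
  have E_Un: "E (M \<union> N) = E M \<union> E N" for M N
    unfolding E_def by (simp add: image_Un)
  have E_subset: "E M \<subseteq> topspace Y" for M unfolding E_def by (rule closure_of_subset_topspace)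
  have E_closed: "closedin Y (E M)" for M unfolding E_def by simp
  have near: "(M, N) \<in> prox \<longleftrightarrow> E M \<inter> E N \<noteq> {}"
    if "M \<subseteq> topspace X" "N \<subseteq> topspace X" for M N
    using that unfolding eq[symmetric] ext_prox_def E_def by simp
  have bdd: "M \<in> bounded_sets \<longleftrightarrow> compactin Y (E M)" if "M \<subseteq> topspace X" for M
    using that unfolding eq[symmetric] ext_prox_def E_def by simp
  have E_disj: "E F \<inter> E (topspace X - F) = {}" if "F \<in> A" for F
    using A_strongly[OF that] near[of F "topspace X - F"] A_subset[OF that] by blast
  have E_union: "E F \<union> E (topspace X - F) = topspace Y" if "F \<in> A" for F
  proof -
    have "F \<union> (topspace X - F) = topspace X" using A_subset[OF that] by blast
    then show ?thesis using E_Un[of F "topspace X - F"] dense by simp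
  qed
  have E_open: "openin Y (E F)" if "F \<in> A" for F
  proof -
    have "E F = topspace Y - E (topspace X - F)" using E_disj[OF that] E_union[OF that] by blast
    then show ?thesis using E_closed by (simp add: openin_diff)
  qed
  \<comment> \<open>Closures do not commute with intersections in general. On A they do, because the
    closures of a set and of its complement partition Y, which turns the claim into the one for
    unions.\<close>
  have E_Int: "E (F \<inter> G) = E F \<inter> E G" if "F \<in> A" "G \<in> A" for F G
  proof
    show "E (F \<inter> G) \<subseteq> E F \<inter> E G" using E_mono by blast
    show "E F \<inter> E G \<subseteq> E (F \<inter> G)"
    proof
      fix y assume y: "y \<in> E F \<inter> E G"
      have "topspace X - (F \<inter> G) = (topspace X - F) \<union> (topspace X - G)" by blast
      then have "E (topspace X - (F \<inter> G)) = E (topspace X - F) \<union> E (topspace X - G)"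
        by (simp only: E_Un)
      then have "y \<notin> E (topspace X - (F \<inter> G))" using y E_disj that by blast
      then show "y \<in> E (F \<inter> G)" using E_union[OF Int[OF that]] y E_subset by blast
    qed
  qed
  \<comment> \<open>Density of the image: the trace on X of an open neighbourhood of y still has y
    in its closure. This translates neighbourhoods in Y into subsets of X, on which the proximity
    speaks.\<close>
  have trace: "y \<in> E {x \<in> topspace X. f x \<in> W}" if W: "openin Y W" "y \<in> W" for W y
  proof -
    have yY: "y \<in> topspace Y" using W openin_subset by blast
    then have y: "y \<in> E (topspace X)" using dense by simp
    have "\<exists>z. z \<in> f ` {x \<in> topspace X. f x \<in> W} \<and> z \<in> T" if T: "y \<in> T \<and> openin Y T" for T
    proof -
      have "y \<in> T \<inter> W \<and> openin Y (T \<inter> W)" using T W by (auto intro: openin_Int)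
      then obtain z where "z \<in> f ` topspace X" "z \<in> T \<inter> W"
        using y unfolding E_def in_closure_of by meson
      then show ?thesis by blast
    qed
    then show ?thesis unfolding E_def in_closure_of using yY by blast
  qed
  have lcE: "\<exists>W K. openin Y W \<and> compactin Y K \<and> closedin Y K \<and> y \<in> W \<and> W \<subseteq> K \<and> K \<subseteq> U"
    if U: "openin Y U" "y \<in> U" for U y
  proof -
    have "neighbourhood_base_of (\<lambda>C. compactin Y C \<and> closedin Y C) Y"
      using lc Haus locally_compact_space_neighbourhood_base_closedin by blast
    then have "\<exists>W K. openin Y W \<and> (compactin Y K \<and> closedin Y K) \<and> y \<in> W \<and> W \<subseteq> K \<and> K \<subseteq> U"
      using U unfolding neighbourhood_base_of by blast
    then show ?thesis by (elim exE conjE) (intro exI conjI)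
  qed
  have E_le: "E {x \<in> topspace X. f x \<in> W} \<subseteq> K" if "closedin Y K" "W \<subseteq> K" for W K
    unfolding E_def using that by (intro closure_of_minimal) auto
  have trace_bdd: "{x \<in> topspace X. f x \<in> W} \<in> bounded_sets"
    if K: "compactin Y K" "closedin Y K" "W \<subseteq> K" for W K
  proof -
    have "compactin Y (E {x \<in> topspace X. f x \<in> W})"
      using closed_compactin[OF K(1) E_le[OF K(2,3)] E_closed] .
    then show ?thesis using bdd[of "{x \<in> topspace X. f x \<in> W}"] by simp
  qed
  \<comment> \<open>Local compactness makes the ultrafilter at y bounded: a neighbourhood inside a
    compact set has a bounded trace, which lies in some G in I.\<close>
  have E_cover: "\<exists>G \<in> I. y \<in> E G" if y: "y \<in> topspace Y" for y
  proof -
    obtain W K where W: "openin Y W" "compactin Y K" "closedin Y K" "y \<in> W" "W \<subseteq> K"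
      using lcE[OF openin_topspace y] by blast
    obtain G where "G \<in> I" "{x \<in> topspace X. f x \<in> W} \<subseteq> G"
      using trace_bdd[OF W(2,3,5)] bounded_sets_iff by blast
    then show ?thesis using trace[OF W(1,4)] E_mono by blast
  qed
  have E_compact: "compactin Y (E G)" if "G \<in> I" for G
    using bdd[OF A_subset[OF I_in_A[OF that]]] bounded_sets_iff that by blast

  define h where "h y = {F \<in> A. y \<in> E F}" for y
  have h_bounded: "h y \<in> bounded_ultrafilters A I" if y: "y \<in> topspace Y" for y
  proof -
    obtain G where G: "G \<in> I" "y \<in> E G" using E_cover[OF y] by blast
    show ?thesis
    proof (rule bounded_ultrafilterI)
      show "h y \<subseteq> A" unfolding h_def by blast
      show "{} \<notin> h y" unfolding h_def E_def by simp
      show "b \<in> h y" if "a \<in> h y" "b \<in> A" "a \<subseteq> b" for a b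
        using that E_mono unfolding h_def by blast
      show "a \<inter> b \<in> h y" if "a \<in> h y" "b \<in> h y" for a b
        using that E_Int Int unfolding h_def by simp
      show "F \<in> h y \<or> topspace X - F \<in> h y" if "F \<in> A" for F
        using that y E_union[OF that] compl_sets unfolding h_def by blast
      show "G \<in> I" "G \<in> h y" using G I_in_A unfolding h_def by simp_all
    qed
  qed
  have h_f: "h (f x) = emb x" if x: "x \<in> topspace X" for x
  proof -
    have "f x \<in> E F \<longleftrightarrow> x \<in> F" if F: "F \<in> A" for F
      using E_mem[of x F] E_mem[of x "topspace X - F"] E_disj[OF F] x A_subset[OF F] by blast
    then show ?thesis unfolding h_def Theta_embedding_def by blast
  qed
  have h_basic: "{y \<in> topspace Y. h y \<in> basic F} = E F" if "F \<in> A" for F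
    using that h_bounded E_subset unfolding h_def by blast
  \<comment> \<open>Distinct points have neighbourhoods inside disjoint closed compact sets. The
    traces of these neighbourhoods are bounded and far, so a member of I contains one and misses the
    other, and it belongs to exactly one of the two ultrafilters.\<close>
  have inj: "inj_on h (topspace Y)"
  proof (rule inj_onI, rule ccontr)
    fix y z assume yz: "y \<in> topspace Y" "z \<in> topspace Y" "h y = h z" "y \<noteq> z"
    have "openin Y (topspace Y - {z})"
      using closedin_Hausdorff_singleton[OF Haus yz(2)] by (simp add: openin_diff)
    then obtain W K where W: "openin Y W" "compactin Y K" "closedin Y K" "y \<in> W" "W \<subseteq> K"
      "K \<subseteq> topspace Y - {z}"
      using lcE[of "topspace Y - {z}" y] yz by blast
    let ?M = "{x \<in> topspace X. f x \<in> W}"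
    have oK: "openin Y (topspace Y - K)" using W(3) by blast
    obtain W' K' where W': "openin Y W'" "compactin Y K'" "closedin Y K'" "z \<in> W'" "W' \<subseteq> K'"
      "K' \<subseteq> topspace Y - K"
      using lcE[OF oK, of z] yz W(6) by blast
    let ?N = "{x \<in> topspace X. f x \<in> W'}"
    have "E ?M \<inter> E ?N = {}" using E_le[OF W(3,5)] E_le[OF W'(3,5)] W'(6) by blast
    then have "(?M, ?N) \<notin> prox" using near[of ?M ?N] by blast
    then obtain F where F: "F \<in> I" "?M \<subseteq> F" "F \<inter> ?N = {}"
      using far_separation[OF _ trace_bdd[OF W(2,3,5)]] by blast
    have "F \<in> h y" using trace[OF W(1,4)] E_mono[OF F(2)] I_in_A[OF F(1)] unfolding h_def by blast
    moreover have "?N \<subseteq> topspace X - F" using F(3) by blast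
    then have "z \<in> E (topspace X - F)" using trace[OF W'(1,4)] E_mono by blast
    then have "F \<notin> h z" using E_disj[OF I_in_A[OF F(1)]] unfolding h_def by blast
    ultimately show False using yz(3) by simp
  qed
  have surj: "h ` topspace Y = topspace (Theta A I)"
  proof
    show "h ` topspace Y \<subseteq> topspace (Theta A I)" using h_bounded topspace_Theta by blast
    show "topspace (Theta A I) \<subseteq> h ` topspace Y"
    proof
      fix u assume "u \<in> topspace (Theta A I)"
      then have u: "u \<in> bounded_ultrafilters A I" using topspace_Theta by simp
      obtain G where G: "G \<in> I" "G \<in> u" using bounded_ultrafilterD(7)[OF u] by blast
      \<comment> \<open>Y need not be compact, so the finite intersection property is used inside
        the compact set \<open>E G\<close> with G in u. A point common to all \<open>E F\<close>
        with F in u satisfies \<open>u \<subseteq> h y\<close>, and maximality of u gives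
        equality.\<close>
      have fip: "\<exists>F \<in> u. E F \<subseteq> E G \<inter> \<Inter>\<F>" if "finite \<F>" "\<F> \<subseteq> E ` u" for \<F>
        using that
      proof (induction \<F> rule: finite_induct)
        case (insert C \<F>)
        then obtain F F' where F: "F \<in> u" "E F \<subseteq> E G \<inter> \<Inter>\<F>" "F' \<in> u" "C = E F'" by blast
        have "E (F \<inter> F') \<subseteq> E G \<inter> \<Inter>(insert C \<F>)"
          using F E_mono[of "F \<inter> F'" F] E_mono[of "F \<inter> F'" F'] by blast
        then show ?case using bounded_ultrafilterD(4)[OF u F(1,3)] by blast
      qed (use G(2) in auto)
      have "E G \<inter> \<Inter>(E ` u) \<noteq> {}"
      proof -
        have "E G \<inter> \<Inter>\<F> \<noteq> {}" if \<F>: "finite \<F> \<and> \<F> \<subseteq> E ` u" for \<F>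
        proof -
          obtain F where F: "F \<in> u" "E F \<subseteq> E G \<inter> \<Inter>\<F>"
            using fip[OF conjunct1[OF \<F>] conjunct2[OF \<F>]] by (elim bexE)
          have "F \<subseteq> topspace X" "F \<noteq> {}"
            using bounded_ultrafilterD(1,2)[OF u] F(1) A_subset by blast+
          then show ?thesis using E_mem F(2) by blast
        qed
        moreover have "\<forall>C \<in> E ` u. closedin Y C" using E_closed by simp
        ultimately show ?thesis
          using conjunct2[OF iffD1[OF compactin_fip E_compact[OF G(1)]]] by simp
      qed
      then obtain y where y: "y \<in> E G" "\<And>F. F \<in> u \<Longrightarrow> y \<in> E F" by blast
      have yY: "y \<in> topspace Y" using y(1) E_subset by blast
      have "u \<subseteq> h y" using y(2) bounded_ultrafilterD(1)[OF u] unfolding h_def by blast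
      moreover have "proper_filter_in A (h y)"
        using bounded_ultrafilterD(6)[OF h_bounded[OF yY]] unfolding ultrafilter_in_def by blast
      ultimately have "h y = u"
        using bounded_ultrafilterD(6)[OF u] unfolding ultrafilter_in_def by blast
      then show "u \<in> h ` topspace Y" using yY by blast
    qed
  qed
  have cont: "continuous_map Y (Theta A I) h"
    unfolding continuous_map_def
  proof (intro conjI allI impI)
    show "h \<in> topspace Y \<rightarrow> topspace (Theta A I)" using surj by blast
    fix U assume U: "openin (Theta A I) U"
    show "openin Y {y \<in> topspace Y. h y \<in> U}"
    proof (subst openin_subopen, intro ballI)
      fix y assume "y \<in> {y \<in> topspace Y. h y \<in> U}"
      then have y: "y \<in> topspace Y" "h y \<in> U" by simp_all
      obtain a where a: "a \<in> I" "a \<in> h y" "basic a \<subseteq> U" using Theta_base_obtain[OF U y(2)] by metis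
      have "E a \<subseteq> {y \<in> topspace Y. h y \<in> U}" using h_basic[OF I_in_A[OF a(1)]] a(3) by blast
      moreover have "y \<in> E a" using a(2) unfolding h_def by blast
      ultimately show "\<exists>T. openin Y T \<and> y \<in> T \<and> T \<subseteq> {y \<in> topspace Y. h y \<in> U}"
        using E_open[OF I_in_A[OF a(1)]] by blast
    qed
  qed
  \<comment> \<open>The compact-to-Hausdorff argument, carried out inside the compact set
    \<open>E G\<close> around the given point: the part of \<open>E G\<close> outside W has a
    compact and hence closed image, and removing this image from \<open>basic G\<close> leaves a
    neighbourhood contained in the image of W.\<close>
  have "open_map Y (Theta A I) h"
    unfolding open_map_def
  proof (intro allI impI)
    fix W assume W: "openin Y W"
    show "openin (Theta A I) (h ` W)"
    proof (subst openin_subopen, intro ballI)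
      fix u assume "u \<in> h ` W"
      then obtain y where y: "y \<in> W" "u = h y" by blast
      have yY: "y \<in> topspace Y" using y W openin_subset by blast
      obtain G where G: "G \<in> I" "y \<in> E G" using E_cover[OF yY] by blast
      have "compactin Y (E G - W)"
      proof (rule closed_compactin[OF E_compact[OF G(1)]])
        show "closedin Y (E G - W)" using E_closed W by (rule closedin_diff)
      qed blast
      then have "compactin (Theta A I) (h ` (E G - W))"
        using cont by (rule image_compactin)
      then have "closedin (Theta A I) (h ` (E G - W))"
        by (rule compactin_imp_closedin[OF Hausdorff_Theta])
      then have "openin (Theta A I) (basic G - h ` (E G - W))"
        by (rule openin_diff[OF openin_basic[OF G(1)]])
      moreover have "u \<in> basic G - h ` (E G - W)"
      proof -
        have "h y \<notin> h ` (E G - W)" using inj yY y(1) E_subset unfolding inj_on_def by blast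
        moreover have "h y \<in> basic G" using h_basic[OF I_in_A[OF G(1)]] G(2) by blast
        ultimately show ?thesis using y(2) by blast
      qed
      moreover have "basic G - h ` (E G - W) \<subseteq> h ` W"
      proof
        fix v assume v: "v \<in> basic G - h ` (E G - W)"
        then obtain z where z: "z \<in> topspace Y" "v = h z" using surj topspace_Theta by blast
        have "z \<in> E G" using h_basic[OF I_in_A[OF G(1)]] z v by blast
        then show "v \<in> h ` W" using v z by blast
      qed
      ultimately show "\<exists>T. openin (Theta A I) T \<and> u \<in> T \<and> T \<subseteq> h ` W" by blast
    qed
  qed
  then have "homeomorphic_map Y (Theta A I) h"
    using cont surj inj by (intro bijective_open_imp_homeomorphic_map)
  then show ?thesis using h_f by blast
qed

end


section \<open>Equivalence of extensions and the Leader map\<close>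

lemma ext_equiv_refl: "e \<in> extensions X \<Longrightarrow> (e, e) \<in> ext_equiv X"
  unfolding ext_equiv_def by (cases e) (auto intro!: exI[of _ id])

lemma ext_equiv_sym:
  assumes "(e, e') \<in> ext_equiv X"
  shows "(e', e) \<in> ext_equiv X"
proof -
  obtain Y f Y' f' where e: "e = (Y, f)" "e' = (Y', f')" by (metis surj_pair)
  then obtain h where ext: "(Y, f) \<in> extensions X" "(Y', f') \<in> extensions X"
    and h: "homeomorphic_map Y Y' h" "\<forall>x \<in> topspace X. h (f x) = f' x"
    using assms unfolding ext_equiv_def by blast
  obtain g where g: "homeomorphic_maps Y Y' h g" using h(1) homeomorphic_map_maps by blast
  have fY: "f x \<in> topspace Y" if "x \<in> topspace X" for x
    using extension_image_subset[OF ext(1)] that by blast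
  have "g (f' x) = f x" if "x \<in> topspace X" for x
    using g h(2) fY that unfolding homeomorphic_maps_def by metis
  moreover have "homeomorphic_map Y' Y g"
    using g homeomorphic_map_maps homeomorphic_maps_sym by blast
  ultimately show ?thesis unfolding e ext_equiv_def using ext by blast
qed

lemma ext_equiv_trans:
  assumes "(e, e') \<in> ext_equiv X" "(e', e'') \<in> ext_equiv X"
  shows "(e, e'') \<in> ext_equiv X"
proof -
  obtain Y f Y' f' Y'' f'' where e: "e = (Y, f)" "e' = (Y', f')" "e'' = (Y'', f'')"
    by (metis surj_pair)
  obtain h h' where ext: "(Y, f) \<in> extensions X" "(Y'', f'') \<in> extensions X"
    and h: "homeomorphic_map Y Y' h" "\<forall>x \<in> topspace X. h (f x) = f' x"
      "homeomorphic_map Y' Y'' h'" "\<forall>x \<in> topspace X. h' (f' x) = f'' x"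
    using assms unfolding e ext_equiv_def by blast
  have "homeomorphic_map Y Y'' (h' \<circ> h)" using h(1,3) by (rule homeomorphic_map_compose)
  then show ?thesis unfolding e ext_equiv_def using ext h(2,4) by auto
qed

lemma ext_equiv_class_eq:
  assumes "(e, e') \<in> ext_equiv X"
  shows "ext_equiv X `` {e} = ext_equiv X `` {e'}"
  using assms by (blast intro: ext_equiv_sym ext_equiv_trans)

lemma ext_prox_cong:
  assumes "(e, e') \<in> ext_equiv X"
  shows "ext_prox X e = ext_prox X e'"
proof -
  obtain Y f Y' f' where e: "e = (Y, f)" "e' = (Y', f')" by (metis surj_pair)
  then obtain h where ext: "(Y, f) \<in> extensions X"
    and h: "homeomorphic_map Y Y' h" "\<forall>x \<in> topspace X. h (f x) = f' x"
    using assms unfolding ext_equiv_def by blast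
  have fY: "f ` topspace X \<subseteq> topspace Y" by (rule extension_image_subset[OF ext])
  have cl: "Y' closure_of (f' ` M) = h ` (Y closure_of (f ` M))" if "M \<subseteq> topspace X" for M
  proof -
    have "f' ` M = h ` f ` M" using h(2) that by (force simp: image_image)
    moreover have "f ` M \<subseteq> topspace Y" using fY that by blast
    ultimately show ?thesis using homeomorphic_map_closure_of[OF h(1), of "f ` M"] by simp
  qed
  have sub: "Y closure_of S \<subseteq> topspace Y" for S by (rule closure_of_subset_topspace)
  have "inj_on h (topspace Y)" using h(1) homeomorphic_eq_everything_map by blast
  then have meet: "h ` (Y closure_of S) \<inter> h ` (Y closure_of T) \<noteq> {} \<longleftrightarrow>
      Y closure_of S \<inter> Y closure_of T \<noteq> {}" for S T
    using inj_on_image_Int[of h "topspace Y" "Y closure_of S" "Y closure_of T"] sub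
    by (metis image_is_empty)
  have comp: "compactin Y' (h ` (Y closure_of S)) \<longleftrightarrow> compactin Y (Y closure_of S)" for S
    using homeomorphic_map_compactness[OF h(1) sub] .
  have near: "(M \<subseteq> topspace X \<and> N \<subseteq> topspace X \<and> Y' closure_of (f' ` M) \<inter> Y' closure_of (f' ` N) \<noteq> {}) \<longleftrightarrow>
      (M \<subseteq> topspace X \<and> N \<subseteq> topspace X \<and> Y closure_of (f ` M) \<inter> Y closure_of (f ` N) \<noteq> {})" for M N
    using cl[of M] cl[of N] meet by (intro conj_cong refl) simp
  have bdd: "(M \<subseteq> topspace X \<and> compactin Y' (Y' closure_of (f' ` M))) \<longleftrightarrow>
      (M \<subseteq> topspace X \<and> compactin Y (Y closure_of (f ` M)))" for M
    using cl[of M] comp by (intro conj_cong refl) simp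
  show ?thesis
    unfolding e ext_prox_def prod.case near bdd ..
qed

text \<open>Justifies \<open>the_elem\<close>: \<open>ext_prox\<close> is constant on the class, and
  reflexivity makes the class nonempty.\<close>

lemma Leader_map_class:
  assumes "e \<in> extensions X"
  shows "Leader_map X (ext_equiv X `` {e}) = ext_prox X e"
proof -
  have "ext_prox X ` (ext_equiv X `` {e}) = (\<lambda>_. ext_prox X e) ` (ext_equiv X `` {e})"
  proof (rule image_cong)
    show "ext_prox X e' = ext_prox X e" if "e' \<in> ext_equiv X `` {e}" for e'
      using ext_prox_cong[of e e' X] that by simp
  qed (rule refl)
  also have "\<dots> = {ext_prox X e}"
    using ext_equiv_refl[OF assms] by (intro image_constant[of e]) simp
  finally have "ext_prox X ` (ext_equiv X `` {e}) = {ext_prox X e}" .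
  then show ?thesis unfolding Leader_map_def by simp
qed

section \<open>The class of the ultrafilter space as a value of the inverse Leader map\<close>

lemma beta0_eq_Leader_inv:
  assumes p: "p \<in> ZA X" and Haus: "Hausdorff_space X"
  shows "beta0 X p = Leader_inv X (prox_of_alg X p)"
proof -
  obtain A I where eq: "p = (A, I)" by (metis surj_pair)
  interpret admissible_pair X A I using ZA_admissible_pair p eq by blast
  let ?e = "(Theta A I, emb)"
  let ?C = "lc_hausdorff_ext_classes X"
  have ext: "?e \<in> extensions X" by (rule Theta_extension[OF Haus])
  have b: "beta0 X p = ext_equiv X `` {?e}" unfolding beta0_def eq by simp
  have mem: "beta0 X p \<in> ?C"
    unfolding lc_hausdorff_ext_classes_def b
    using ext locally_compact_Theta Hausdorff_Theta by (intro quotientI) simp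
  have val: "Leader_map X (beta0 X p) = prox_of_alg X p"
    unfolding b Leader_map_class[OF ext] ext_prox_Theta unfolding eq by (rule refl)
  \<comment> \<open>\<open>Leader_inv\<close> is a choice of preimage, so being one preimage does
    not identify its value. Uniqueness over this particular proximity takes the place of injectivity
    of \<open>Leader_map\<close> on all classes.\<close>
  have unique: "c = beta0 X p" if c: "c \<in> ?C" "Leader_map X c = prox_of_alg X p" for c
  proof -
    obtain Y f where Y: "(Y, f) \<in> extensions X" "locally_compact_space Y" "Hausdorff_space Y"
      "c = ext_equiv X `` {(Y, f)}"
      using c(1) unfolding lc_hausdorff_ext_classes_def quotient_def by auto
    have "ext_prox X (Y, f) = prox_of_alg X (A, I)"
      using c(2) Leader_map_class[OF Y(1)] Y(4) eq by simp
    then have "((Y, f), ?e) \<in> ext_equiv X"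
      using extension_homeomorphic_Theta[OF Y(1-3)] Y(1) ext unfolding ext_equiv_def by simp
    then show ?thesis using ext_equiv_class_eq Y(4) b by metis
  qed
  show ?thesis
    unfolding Leader_inv_def inv_into_def
  proof (rule some_equality[symmetric])
    show "beta0 X p \<in> ?C \<and> Leader_map X (beta0 X p) = prox_of_alg X p" using mem val by (rule conjI)
    show "c = beta0 X p" if "c \<in> ?C \<and> Leader_map X c = prox_of_alg X p" for c
      using unique that by simp
  qed
qed

lemma prox_of_alg_in_LP0:
  assumes "p \<in> ZA X" "Hausdorff_space X"
  shows "prox_of_alg X p \<in> LP0 X"
  using assms admissible_pair.prox_of_alg_LP0[OF ZA_admissible_pair] by (cases p) simp

lemma alg_of_prox_in_ZA: "q \<in> LP0 X \<Longrightarrow> alg_of_prox X q \<in> ZA X"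
  using zero_dim_local_proximity.alg_of_prox_ZA[OF zero_dim_local_proximity.intro]
  by (cases q) simp

lemma prox_of_alg_inverse: "q \<in> LP0 X \<Longrightarrow> prox_of_alg X (alg_of_prox X q) = q"
  using zero_dim_local_proximity.prox_of_alg_of_prox[OF zero_dim_local_proximity.intro]
  by (cases q) simp

lemma alg_of_prox_inverse: "p \<in> ZA X \<Longrightarrow> alg_of_prox X (prox_of_alg X p) = p"
  using alg_of_prox_of_alg by (cases p) simp

theorem theorem3p4:
  fixes X :: "'a topology"
  assumes "zero_dimensional_space X" and "Hausdorff_space X"
  shows "(\<forall>p \<in> ZA X. prox_of_alg X p \<in> LP0 X) \<and>
         (\<forall>q \<in> LP0 X. alg_of_prox X q \<in> ZA X) \<and>
         (\<forall>p \<in> ZA X. beta0 X p = Leader_inv X (prox_of_alg X p)) \<and>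
         (\<forall>q \<in> LP0 X. beta0 X (alg_of_prox X q) = Leader_inv X q) \<and>
         poset_isomorphism (ZA X) ZA_le (LP0 X) LP_le (prox_of_alg X) \<and>
         (\<forall>q \<in> LP0 X. inv_into (ZA X) (prox_of_alg X) q = alg_of_prox X q)"
proof -
  note L = prox_of_alg_in_LP0[OF _ assms(2)] and l = alg_of_prox_in_ZA
  have bij: "bij_betw (prox_of_alg X) (ZA X) (LP0 X)"
    by (rule bij_betwI[where g = "alg_of_prox X"])
      (auto simp: L l prox_of_alg_inverse alg_of_prox_inverse)
  \<comment> \<open>The order axioms are pulled back from the inclusions in \<open>LP_le\<close>;
    antisymmetry is the one that needs \<open>prox_of_alg X\<close> to be injective.\<close>
  have "is_poset (ZA X) ZA_le"
    unfolding is_poset_def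
  proof (intro conjI)
    show "reflp_on (ZA X) ZA_le"
      by (rule reflp_onI) (auto simp: ZA_le_iff_LP_le LP_le_def)
    show "transp_on (ZA X) ZA_le"
      by (rule transp_onI) (auto simp: ZA_le_iff_LP_le LP_le_def split: prod.splits)
    show "antisymp_on (ZA X) ZA_le"
    proof (rule antisymp_onI)
      fix p q assume pq: "p \<in> ZA X" "q \<in> ZA X" "ZA_le p q" "ZA_le q p"
      then have "prox_of_alg X p = prox_of_alg X q"
        by (auto simp: ZA_le_iff_LP_le LP_le_def split: prod.splits)
      then show "p = q" using alg_of_prox_inverse pq(1,2) by metis
    qed
  qed
  then have "poset_isomorphism (ZA X) ZA_le (LP0 X) LP_le (prox_of_alg X)"
    unfolding poset_isomorphism_def using is_poset_LP_le bij ZA_le_iff_LP_le by blast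
  moreover have "inv_into (ZA X) (prox_of_alg X) q = alg_of_prox X q" if "q \<in> LP0 X" for q
    using inv_into_f_eq[OF bij_betw_imp_inj_on[OF bij] l prox_of_alg_inverse] that by blast
  moreover have "beta0 X (alg_of_prox X q) = Leader_inv X q" if "q \<in> LP0 X" for q
    using beta0_eq_Leader_inv[OF l[OF that] assms(2)] prox_of_alg_inverse[OF that] by simp
  ultimately show ?thesis
    using L l beta0_eq_Leader_inv[OF _ assms(2)] by blast
qed

end
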